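(* For integers $a,b\geq 1$ with $a+b\geq 3$, the graph $\mathcal{F}_{(a,b)}$ is isomorphic to the flip graph of $(a-1,b-1)$-combinations under adjacent transpositions. Consequently, $\mathcal{F}_{(a,b)}$ has a Hamilton path if and only if $a\in\{1,2\}$, or $b\in\{1,2\}$, or $a$ and $b$ are both even. Furthermore, if $a,b\geq 2$, then $\mathcal{F}_{(a,b)}$ has no Hamilton cycle.
   Context: Let $N=a+b$ and label the points of a convex $N$-gon $1,\ldots,N$ counterclockwise; color the first $a$ points red and the remaining $b$ points blue. The associahedron $\mathcal{G}_N$ has as nodes all triangulations of the convex $N$-gon, two adjacent if they differ in a flip (removing a diagonal shared by two triangles and replacing it by the other diagonal of the resulting quadrilateral). A triangulation is colorful if no triangle has all three points of the same color; $\mathcal{F}_{(a,b)}$ is the subgraph of $\mathcal{G}_N$ induced by the colorful triangulations. An $(a-1,b-1)$-combination is a bitstring of length $N-2$ with exactly $a-1$ zeros and $b-1$ ones; the flip graph of these under adjacent transpositions has an edge between two such bitstrings if one arises from the other by swapping two adjacent (distinct) bits. *)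

theory Defs
  imports "Graph_Theory.Graph_Theory"
begin

section \<open>Triangulations of a convex polygon\<close>

text \<open>
  The points of the convex \<open>N\<close>-gon are the numbers \<open>1, \<dots>, N\<close> in counterclockwise order, a segment
  between two points is the set of its endpoints, and a triangulation is given by its set of
  diagonals.
\<close>

definition polygon_sides :: "nat \<Rightarrow> nat set set" where
  "polygon_sides N = {{i, Suc i} | i. 1 \<le> i \<and> i < N} \<union> {{N, 1}}"

definition diagonals :: "nat \<Rightarrow> nat set set" where
  "diagonals N = {{i, j} | i j. i \<in> {1..N} \<and> j \<in> {1..N} \<and> i \<noteq> j} - polygon_sides N"

text \<open>
  Two segments between points in convex position meet in their relative interiors without
  overlapping if and only if their endpoints are four distinct points that alternate along the
  boundary.
\<close>

definition crossing :: "nat set \<Rightarrow> nat set \<Rightarrow> bool" where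
  "crossing e f \<longleftrightarrow> (\<exists>i j k l. i < j \<and> j < k \<and> k < l \<and> {e, f} = {{i, k}, {j, l}})"

definition triangulation :: "nat \<Rightarrow> nat set set \<Rightarrow> bool" where
  "triangulation N T \<longleftrightarrow>
     T \<subseteq> diagonals N \<and>
     (\<forall>e\<in>T. \<forall>f\<in>T. \<not> crossing e f) \<and>
     (\<forall>d\<in>diagonals N - T. \<exists>e\<in>T. crossing d e)"

text \<open>
  As there are no points inside the polygon, any three points that are pairwise joined by a side
  or by a diagonal of \<open>T\<close> bound a triangular face.
\<close>

definition triangles :: "nat \<Rightarrow> nat set set \<Rightarrow> nat set set" where
  "triangles N T = {{p, q, r} | p q r. p \<noteq> q \<and> q \<noteq> r \<and> p \<noteq> r \<and>
     {{p, q}, {q, r}, {p, r}} \<subseteq> polygon_sides N \<union> T}"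

text \<open>
  The triangles \<open>pqr\<close> and \<open>pqs\<close> lie on different sides of their common diagonal \<open>pq\<close>, so \<open>rs\<close> is
  the other diagonal of the quadrilateral \<open>prqs\<close>.
\<close>

definition flip :: "nat \<Rightarrow> nat set set \<Rightarrow> nat set set \<Rightarrow> bool" where
  "flip N T T' \<longleftrightarrow> (\<exists>p q r s. {p, q} \<in> T \<and> r \<noteq> s \<and>
     {p, q, r} \<in> triangles N T \<and> {p, q, s} \<in> triangles N T \<and>
     T' = (T - {{p, q}}) \<union> {{r, s}})"

text \<open>
  Undirected graphs are represented by digraphs with a symmetric set of arcs.
\<close>

definition associahedron :: "nat \<Rightarrow> (nat set set, nat set set \<times> nat set set) pre_digraph" where
  "associahedron N = with_proj
     \<lparr> pverts = {T. triangulation N T},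
       parcs = {(T, T'). triangulation N T \<and> triangulation N T' \<and> flip N T T'} \<rparr>"


section \<open>Colorful triangulations\<close>

definition red_points :: "nat \<Rightarrow> nat \<Rightarrow> nat set" where
  "red_points a b = {1..a}"

definition blue_points :: "nat \<Rightarrow> nat \<Rightarrow> nat set" where
  "blue_points a b = {a + 1..a + b}"

definition colorful :: "nat \<Rightarrow> nat \<Rightarrow> nat set set \<Rightarrow> bool" where
  "colorful a b T \<longleftrightarrow>
     (\<forall>t\<in>triangles (a + b) T. \<not> t \<subseteq> red_points a b \<and> \<not> t \<subseteq> blue_points a b)"

definition colorful_flip_graph ::
    "nat \<Rightarrow> nat \<Rightarrow> (nat set set, nat set set \<times> nat set set) pre_digraph" where
  "colorful_flip_graph a b =
     associahedron (a + b) \<restriction> {T \<in> verts (associahedron (a + b)). colorful a b T}"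


section \<open>Combinations under adjacent transpositions\<close>

text \<open>The bit 0 is \<^const>\<open>False\<close>, the bit 1 is \<^const>\<open>True\<close>.\<close>

definition combinations :: "nat \<Rightarrow> nat \<Rightarrow> bool list set" where
  "combinations k l =
     {w. length w = k + l \<and> count_list w False = k \<and> count_list w True = l}"

definition adjacent_transposition :: "bool list \<Rightarrow> bool list \<Rightarrow> bool" where
  "adjacent_transposition v w \<longleftrightarrow>
     (\<exists>i. Suc i < length v \<and> v ! i \<noteq> v ! Suc i \<and> w = v[i := v ! Suc i, Suc i := v ! i])"

definition combination_graph ::
    "nat \<Rightarrow> nat \<Rightarrow> (bool list, bool list \<times> bool list) pre_digraph" where
  "combination_graph k l = with_proj
     \<lparr> pverts = combinations k l,
       parcs = {(v, w). v \<in> combinations k l \<and> w \<in> combinations k l \<and>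
                        adjacent_transposition v w} \<rparr>"


section \<open>Hamilton paths and cycles\<close>

definition has_hamilton_path :: "('a, 'b) pre_digraph \<Rightarrow> bool" where
  "has_hamilton_path G \<longleftrightarrow> (\<exists>p. vpath p G \<and> set p = verts G)"

text \<open>
  A cycle in an undirected graph has at least three vertices; in particular, traversing a single
  edge back and forth does not count as a cycle.
\<close>

definition has_hamilton_cycle :: "('a, 'b) pre_digraph \<Rightarrow> bool" where
  "has_hamilton_cycle G \<longleftrightarrow>
     (\<exists>p. vpath p G \<and> set p = verts G \<and> 3 \<le> length p \<and> (last p, hd p) \<in> arcs_ends G)"

end

theory Submission
  imports Defs
begin

text \<open>
  A colorful triangulation has no diagonal between points of the same color, since the triangle on
  its monochromatic side would be monochromatic. The segments between a red and a blue point form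
  an \<open>a \<times> b\<close> grid in which non-crossing means comparable, so colorful triangulations are the maximal
  chains of the grid, i.e. lattice paths with \<open>a - 1\<close> and \<open>b - 1\<close> steps of the two kinds, and a flip
  exchanges two consecutive distinct steps.

  Write \<open>C(k,l)\<close> for the graph of combinations. It is bipartite by the parity of inversions, and the
  difference \<open>D(k,l)\<close> of the class sizes satisfies \<open>D(k,l) = D(k-2,l) + D(k,l-2)\<close>, as the words that start
  with \<open>01\<close> and \<open>10\<close> cancel. So \<open>D(k,l) \<ge> 2\<close> if \<open>k, l \<ge> 2\<close> are not both odd, which excludes a Hamilton path.
  For \<open>k, l\<close> both odd a Hamilton path from \<open>0\<^sup>k1\<^sup>l\<close> to \<open>1\<^sup>l0\<^sup>k\<close> runs through the words that start with
  \<open>00\<close>, then through those that start with \<open>01\<close> or \<open>10\<close>, and then through those that start with \<open>11\<close>.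
  The middle part is the prism over \<open>C(k-1,l-1)\<close>, where both parameters are even; its Hamilton paths
  are constructed by splitting off two further bits. There is no Hamilton cycle because \<open>0\<^sup>k1\<^sup>l\<close> has
  degree at most 1.
\<close>

section \<open>Hamilton paths and cycles of a relation on a set\<close>

text \<open>The ends are arguments so that paths can be glued at prescribed vertices, and the
  relation is arbitrary so that the same lemmas serve words, prisms and triangulations.\<close>

definition ham_path :: "('a \<Rightarrow> 'a \<Rightarrow> bool) \<Rightarrow> 'a set \<Rightarrow> 'a \<Rightarrow> 'a \<Rightarrow> bool" where
  "ham_path R S x y \<longleftrightarrow>
     (\<exists>p. p \<noteq> [] \<and> distinct p \<and> set p = S \<and> successively R p \<and> hd p = x \<and> last p = y)"

definition ham_cycle :: "('a \<Rightarrow> 'a \<Rightarrow> bool) \<Rightarrow> 'a set \<Rightarrow> bool" where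
  "ham_cycle R S \<longleftrightarrow>
     (\<exists>p. distinct p \<and> set p = S \<and> successively R p \<and> 3 \<le> length p \<and> R (last p) (hd p))"

lemma ham_path_singleton: "ham_path R {x} x x"
  unfolding ham_path_def by (rule exI[of _ "[x]"]) simp

lemma ham_path_join:
  assumes "ham_path R S x y" "ham_path R S' x' y'" "R y x'" "S \<inter> S' = {}"
  shows "ham_path R (S \<union> S') x y'"
proof -
  obtain p where "p \<noteq> []" "distinct p" "set p = S" "successively R p" "hd p = x" "last p = y"
    using assms(1) unfolding ham_path_def by blast
  moreover obtain q where
    "q \<noteq> []" "distinct q" "set q = S'" "successively R q" "hd q = x'" "last q = y'"
    using assms(2) unfolding ham_path_def by blast
  ultimately show ?thesis
    unfolding ham_path_def using assms(3,4)
    by (intro exI[of _ "p @ q"]) (simp add: successively_append_iff)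
qed

lemma ham_path_pair: "R x y \<Longrightarrow> x \<noteq> y \<Longrightarrow> ham_path R {x, y} x y"
  using ham_path_join[OF ham_path_singleton ham_path_singleton, of R x y] by (simp add: insert_commute)

lemma ham_path_rev:
  assumes "symp R" "ham_path R S x y"
  shows "ham_path R S y x"
proof -
  obtain p where "p \<noteq> []" "distinct p" "set p = S" "successively R p" "hd p = x" "last p = y"
    using assms(2) unfolding ham_path_def by blast
  moreover from this have "successively (\<lambda>x y. R y x) p"
    using assms(1) by (auto simp: symp_def elim: successively_mono)
  ultimately show ?thesis
    unfolding ham_path_def
    by (intro exI[of _ "rev p"]) (simp add: hd_rev last_rev)
qed

lemma ham_path_image:
  assumes "ham_path R S x y" "inj_on f S"
    and "\<And>u v. u \<in> S \<Longrightarrow> v \<in> S \<Longrightarrow> R u v \<Longrightarrow> R' (f u) (f v)"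
  shows "ham_path R' (f ` S) (f x) (f y)"
proof -
  obtain p where p: "p \<noteq> []" "distinct p" "set p = S" "successively R p" "hd p = x" "last p = y"
    using assms(1) unfolding ham_path_def by blast
  have "successively (\<lambda>u v. R' (f u) (f v)) p"
    using p(3,4) assms(3) by (auto elim: successively_mono)
  with p assms(2) show ?thesis
    unfolding ham_path_def
    by (intro exI[of _ "map f p"]) (simp add: successively_map distinct_map hd_map last_map)
qed

lemma ham_cycleI:
  assumes "ham_path R S x y" "R y x" "3 \<le> card S"
  shows "ham_cycle R S"
  using assms unfolding ham_path_def ham_cycle_def by (metis distinct_card)

text \<open>Rotate the cycle so that \<open>v\<close> comes first. Its successor and the last vertex
  are distinct because there are at least three vertices, and dropping either of the two edges at
  \<open>v\<close> leaves a Hamilton path. This forces both edges at a vertex of degree two and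
  excludes vertices of degree at most one.\<close>

lemma ham_cycle_neighbours:
  assumes "symp R" "ham_cycle R S" "v \<in> S"
  obtains m n where "m \<noteq> n" "m \<in> S" "n \<in> S" "R v m" "R v n" "ham_path R S v m" "ham_path R S v n"
proof -
  obtain p where p: "distinct p" "set p = S" "successively R p" "3 \<le> length p" "R (last p) (hd p)"
    using assms(2) unfolding ham_cycle_def by blast
  obtain p1 p2 where p12: "p = p1 @ v # p2"
    using assms(3) p(2) by (metis split_list)
  define q where "q = p2 @ p1"
  have "2 \<le> length q"
    using p(4) p12 by (simp add: q_def)
  have q: "distinct (v # q)" "set (v # q) = S"
    using p p12 by (auto simp: q_def)
  have "successively R (p1 @ v # p2)" "R (last (p1 @ v # p2)) (hd (p1 @ v # p2))"
    using p(3,5) p12 by auto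
  moreover have "p1 \<noteq> [] \<or> p2 \<noteq> []"
    using \<open>2 \<le> length q\<close> by (auto simp: q_def)
  ultimately have sq: "successively R (v # q)" "R (last q) v"
    unfolding q_def by (cases "p1 = []"; cases "p2 = []";
      simp add: successively_append_iff successively_Cons)+
  obtain m q' where mq: "q = m # q'" "q' \<noteq> []"
    using \<open>2 \<le> length q\<close> by (cases q; cases "tl q") auto
  have "ham_path R S v (last q)"
    unfolding ham_path_def using q sq mq by (intro exI[of _ "v # q"]) auto
  moreover have "ham_path R S m v"
    unfolding ham_path_def using q sq mq
    by (intro exI[of _ "q @ [v]"]) (auto simp: successively_append_iff successively_Cons)
  moreover have "m \<noteq> last q" "m \<in> S" "last q \<in> S" "R v m" "R v (last q)"
    using q sq mq \<open>symp R\<close> by (auto simp: symp_def)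
  ultimately show thesis
    using that ham_path_rev[OF \<open>symp R\<close>] by metis
qed

text \<open>Each block \<open>F g\<close> is a path between two ends, and consecutive blocks are
  joined at both ends, so the blocks can be run through in alternating directions. The end at which
  a block is entered switches each time, hence the parity of the length decides where the path
  stops.\<close>

lemma ham_path_zigzag:
  assumes "symp R" "gs \<noteq> []" "distinct gs"
    and "\<And>g. g \<in> set gs \<Longrightarrow> ham_path R (F g) (e True g) (e False g)"
    and "\<And>g h. g \<in> set gs \<Longrightarrow> h \<in> set gs \<Longrightarrow> g \<noteq> h \<Longrightarrow> F g \<inter> F h = {}"
    and "successively (\<lambda>g h. \<forall>c. R (e c g) (e c h)) gs"
  shows "ham_path R (\<Union>g\<in>set gs. F g) (e c (hd gs)) (e (c = even (length gs)) (last gs))"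
  using assms(2-)
proof (induction gs arbitrary: c)
  case (Cons g gs)
  have g: "ham_path R (F g) (e c g) (e (\<not> c) g)"
    using Cons.prems(3)[of g] ham_path_rev[OF \<open>symp R\<close>] by (cases c) auto
  show ?case
  proof (cases "gs = []")
    case False
    have "ham_path R (\<Union>g\<in>set gs. F g) (e (\<not> c) (hd gs)) (e ((\<not> c) = even (length gs)) (last gs))"
      using False Cons.prems by (intro Cons.IH) (auto simp: successively_Cons)
    moreover have "R (e (\<not> c) g) (e (\<not> c) (hd gs))"
      using False Cons.prems(5) by (simp add: successively_Cons)
    moreover have "F g \<inter> (\<Union>g\<in>set gs. F g) = {}"
      using Cons.prems(2,4) by fastforce
    ultimately have
      "ham_path R (F g \<union> (\<Union>g\<in>set gs. F g)) (e c g) (e ((\<not> c) = even (length gs)) (last gs))"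
      using ham_path_join[OF g] by blast
    then show ?thesis
      using False by (cases c) simp_all
  qed (use g in auto)
qed simp


section \<open>Adjacent transpositions of words\<close>

abbreviation (input) "adj \<equiv> adjacent_transposition"
abbreviation zeros :: "nat \<Rightarrow> bool list" where "zeros n \<equiv> replicate n False"
abbreviation ones :: "nat \<Rightarrow> bool list" where "ones n \<equiv> replicate n True"

lemma adj_iff_append:
  "adj v w \<longleftrightarrow> (\<exists>x c y. v = x @ c # (\<not> c) # y \<and> w = x @ (\<not> c) # c # y)"
proof
  assume "adj v w"
  then obtain i where i: "Suc i < length v" "v ! i \<noteq> v ! Suc i" "w = v[i := v ! Suc i, Suc i := v ! i]"
    unfolding adjacent_transposition_def by blast
  have v: "v = take i v @ v ! i # v ! Suc i # drop (Suc (Suc i)) v"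
    using i(1) by (metis Cons_nth_drop_Suc Suc_lessD append_take_drop_id)
  define x where "x = take i v"
  define y where "y = drop (Suc (Suc i)) v"
  have [simp]: "length x = i" using i(1) by (simp add: x_def)
  obtain c d where v': "v = x @ c # d # y"
    using v by (auto simp: x_def y_def)
  have "d = (\<not> c)" using i(2) unfolding v' by (auto simp: nth_append)
  moreover have "w = x @ d # c # y"
    using i(3) unfolding v' by (simp add: nth_append list_update_append)
  ultimately show "\<exists>x c y. v = x @ c # (\<not> c) # y \<and> w = x @ (\<not> c) # c # y"
    using v' by blast
next
  assume "\<exists>x c y. v = x @ c # (\<not> c) # y \<and> w = x @ (\<not> c) # c # y"
  then obtain x c y where "v = x @ c # (\<not> c) # y" "w = x @ (\<not> c) # c # y" by blast
  then show "adj v w"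
    unfolding adjacent_transposition_def
    by (intro exI[of _ "length x"]) (simp add: nth_append list_update_append)
qed

lemma not_adj_Nil [simp]: "\<not> adj [] w" "\<not> adj w []"
  by (auto simp: adj_iff_append)

lemma adj_Cons:
  "adj (c # v) (d # w) \<longleftrightarrow> (c = d \<and> adj v w) \<or> (c \<noteq> d \<and> (\<exists>z. v = d # z \<and> w = c # z))"
proof
  assume "adj (c # v) (d # w)"
  then obtain x b y where *: "c # v = x @ b # (\<not> b) # y" "d # w = x @ (\<not> b) # b # y"
    unfolding adj_iff_append by blast
  show "(c = d \<and> adj v w) \<or> (c \<noteq> d \<and> (\<exists>z. v = d # z \<and> w = c # z))"
    using * by (cases x) (auto simp: adj_iff_append)
next
  assume "(c = d \<and> adj v w) \<or> (c \<noteq> d \<and> (\<exists>z. v = d # z \<and> w = c # z))"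
  then show "adj (c # v) (d # w)"
  proof
    assume *: "c = d \<and> adj v w"
    then obtain x b y where "v = x @ b # (\<not> b) # y" "w = x @ (\<not> b) # b # y"
      unfolding adj_iff_append by blast
    with * show ?thesis
      unfolding adj_iff_append by (intro exI[of _ "c # x"]) auto
  next
    assume *: "c \<noteq> d \<and> (\<exists>z. v = d # z \<and> w = c # z)"
    then show ?thesis
      unfolding adj_iff_append by (intro exI[of _ "[]"]) auto
  qed
qed

lemma symp_adj: "symp adj"
proof (rule sympI)
  fix v w assume "adj v w"
  then obtain x c y where "v = x @ c # (\<not> c) # y" "w = x @ (\<not> c) # c # y"
    unfolding adj_iff_append by blast
  then show "adj w v"
    unfolding adj_iff_append by (intro exI[of _ x] exI[of _ "\<not> c"] exI[of _ y]) simp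
qed

lemma not_adj_zeros: "\<not> adj (zeros p) w"
proof (induction p arbitrary: w)
  case (Suc p)
  then show ?case by (cases w; cases p) (auto simp: adj_Cons)
qed simp

text \<open>There is only one place where two neighbouring bits differ. If \<open>p = 0\<close> or
  \<open>q = 0\<close> there is no such place and the premise is false, so the truncated
  subtractions do no harm.\<close>

lemma adj_ones_zeros: "adj (ones q @ zeros p) w \<Longrightarrow> w = ones (q - 1) @ False # True # zeros (p - 1)"
proof (induction q arbitrary: w)
  case 0
  then show ?case by (simp add: not_adj_zeros)
next
  case (Suc q)
  show ?case
  proof (cases w)
    case (Cons c w')
    show ?thesis
    proof (cases q)
      case 0
      then show ?thesis
        using Suc.prems Cons not_adj_zeros[of p] by (cases p) (auto simp: adj_Cons)
    next
      case (Suc n)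
      then show ?thesis
        using Suc.prems Suc.IH[of w'] Cons by (auto simp: adj_Cons)
    qed
  qed (use Suc in auto)
qed

lemma adj_map_Not: "adj (map Not v) (map Not w) \<longleftrightarrow> adj v w"
proof -
  have *: "adj (map Not v) (map Not w)" if "adj v w" for v w
    using that unfolding adj_iff_append by (metis (no_types, lifting) list.simps(9) map_append)
  show ?thesis
    using *[of v w] *[of "map Not v" "map Not w"] by (auto simp: comp_def)
qed

text \<open>Complementing all bits is an automorphism that reduces this to
  \<open>adj_ones_zeros\<close>.\<close>

lemma adj_zeros_ones:
  assumes "adj (zeros p @ ones q) w"
  shows "w = zeros (p - 1) @ True # False # ones (q - 1)"
proof -
  have "adj (ones p @ zeros q) (map Not w)"
    using assms adj_map_Not[of "zeros p @ ones q" w] by (simp add: map_replicate_const)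
  then have "map Not (map Not w) = map Not (ones (p - 1) @ False # True # zeros (q - 1))"
    by (subst adj_ones_zeros) auto
  then show ?thesis
    by (simp add: comp_def)
qed


section \<open>Recursive structure of combinations\<close>

lemma length_eq_count_list: "length w = count_list w False + count_list w True"
  by (induction w) auto

lemma in_combinations_iff: "w \<in> combinations k l \<longleftrightarrow> count_list w False = k \<and> count_list w True = l"
  using length_eq_count_list[of w] by (auto simp: combinations_def)

lemma count_list_replicate: "count_list (replicate n x) y = (if x = y then n else 0)"
  by (induction n) auto

lemma finite_combinations: "finite (combinations k l)"
proof (rule finite_subset)
  show "combinations k l \<subseteq> {w. set w \<subseteq> UNIV \<and> length w = k + l}"
    by (auto simp: combinations_def)
  show "finite {w :: bool list. set w \<subseteq> UNIV \<and> length w = k + l}"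
    by (rule finite_lists_length_eq) simp
qed

lemma Cons_in_combinations_iff:
  "c # w \<in> combinations k l \<longleftrightarrow>
     (if c then 0 < l \<and> w \<in> combinations k (l - 1) else 0 < k \<and> w \<in> combinations (k - 1) l)"
  by (auto simp: in_combinations_iff)

lemma Nil_in_combinations_iff: "[] \<in> combinations k l \<longleftrightarrow> k = 0 \<and> l = 0"
  by (auto simp: in_combinations_iff)

lemma combinations_0_left: "combinations 0 l = {ones l}"
proof -
  have "w = ones l" if "w \<in> combinations 0 l" for w
    using that by (induction w arbitrary: l)
      (auto simp: Cons_in_combinations_iff Nil_in_combinations_iff Cons_replicate_eq split: if_splits)
  then show ?thesis by (auto simp: in_combinations_iff count_list_replicate)
qed

lemma combinations_0_right: "combinations k 0 = {zeros k}"
proof -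
  have "w = zeros k" if "w \<in> combinations k 0" for w
    using that by (induction w arbitrary: k)
      (auto simp: Cons_in_combinations_iff Nil_in_combinations_iff Cons_replicate_eq split: if_splits)
  then show ?thesis by (auto simp: in_combinations_iff count_list_replicate)
qed

lemma combinations_Suc_Suc:
  "combinations (Suc k) (Suc l) =
     (#) False ` combinations k (Suc l) \<union> (#) True ` combinations (Suc k) l"
proof (rule set_eqI)
  fix w show "w \<in> combinations (Suc k) (Suc l) \<longleftrightarrow>
    w \<in> (#) False ` combinations k (Suc l) \<union> (#) True ` combinations (Suc k) l"
    by (cases w; cases "hd w") (auto simp: Cons_in_combinations_iff Nil_in_combinations_iff)
qed

section \<open>Words with two distinct leading bits as a prism\<close>

definition mixed :: "bool \<Rightarrow> bool list \<Rightarrow> bool list" where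
  "mixed c w = c # (\<not> c) # w"

text \<open>The vertices of the Cartesian product of \<open>S\<close> with a single edge: the two
  leading bits name the copy of \<open>S\<close>, and exchanging them moves to the other copy.
  \<open>adj_mixed\<close> confirms the adjacency.\<close>

definition prism :: "bool list set \<Rightarrow> bool list set" where
  "prism S = (\<Union>w\<in>S. {mixed True w, mixed False w})"

lemma mixed_eq_iff [simp]: "mixed c v = mixed d w \<longleftrightarrow> c = d \<and> v = w"
  by (auto simp: mixed_def)

lemma mixed_in_prism_iff [simp]: "mixed c w \<in> prism S \<longleftrightarrow> w \<in> S"
  by (cases c) (auto simp: prism_def)

lemma in_prismE:
  assumes "v \<in> prism S"
  obtains c w where "v = mixed c w" "w \<in> S"
  using assms by (auto simp: prism_def)

lemma adj_mixed: "adj (mixed c v) (mixed d w) \<longleftrightarrow> (if c = d then adj v w else v = w)"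
  by (cases c; cases d) (auto simp: mixed_def adj_Cons)

lemma card_prism: "finite S \<Longrightarrow> card (prism S) = 2 * card S"
  unfolding prism_def by (subst card_UN_disjoint) (auto simp: card_insert_if)

text \<open>The two leading bits are 00, distinct, or 11. Both the count of signs and the
  construction of paths recurse along this partition.\<close>

lemma combinations_Suc_Suc_Suc_Suc:
  "combinations (Suc (Suc k)) (Suc (Suc l)) =
     (\<lambda>w. False # False # w) ` combinations k (Suc (Suc l)) \<union>
     prism (combinations (Suc k) (Suc l)) \<union>
     (\<lambda>w. True # True # w) ` combinations (Suc (Suc k)) l"
proof -
  have "(#) False ` combinations (Suc k) (Suc (Suc l)) \<union> (#) True ` combinations (Suc (Suc k)) (Suc l)
    = (\<lambda>w. False # False # w) ` combinations k (Suc (Suc l)) \<union>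
     prism (combinations (Suc k) (Suc l)) \<union>
     (\<lambda>w. True # True # w) ` combinations (Suc (Suc k)) l"
    by (subst combinations_Suc_Suc, subst (2) combinations_Suc_Suc)
      (auto simp: prism_def mixed_def image_Un image_image)
  then show ?thesis by (simp add: combinations_Suc_Suc)
qed


section \<open>Signs\<close>

text \<open>\<open>(-1)\<close> to the number of inversions.\<close>

fun sign :: "bool list \<Rightarrow> int" where
  "sign [] = 1"
| "sign (c # w) = (if c then (-1) ^ count_list w False else 1) * sign w"

text \<open>Exchanging two distinct neighbouring bits changes the number of inversions by exactly
  one.\<close>

lemma sign_adj: "adj v w \<Longrightarrow> sign w = - sign v"
proof -
  have "sign (x @ True # False # y) = - sign (x @ False # True # y)" for x y
    by (induction x) auto
  then show "adj v w \<Longrightarrow> sign w = - sign v"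
    unfolding adj_iff_append by (metis (full_types) add.inverse_inverse)
qed

lemma abs_sign: "\<bar>sign w\<bar> = 1"
  by (induction w) (auto simp: abs_mult power_abs)

lemma sign_last: "p \<noteq> [] \<Longrightarrow> successively adj p \<Longrightarrow> sign (last p) = (-1) ^ (length p - 1) * sign (hd p)"
proof (induction p rule: induct_list012)
  case (3 x y zs)
  then show ?case using sign_adj[of x y] by simp
qed auto

text \<open>Signs alternate along a walk, so they cancel in pairs and at most one of them is
  left.\<close>

lemma abs_sum_list_sign:
  assumes "successively adj p"
  shows "\<bar>\<Sum>w\<leftarrow>p. sign w\<bar> \<le> 1"
proof -
  have "(p \<noteq> [] \<longrightarrow> (\<Sum>w\<leftarrow>p. sign w) = sign (hd p)) \<or> (\<Sum>w\<leftarrow>p. sign w) = 0"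
    using assms
  proof (induction p rule: induct_list012)
    case (3 x y zs)
    then show ?case using sign_adj[of x y] by auto
  qed auto
  then show ?thesis
    using abs_sign by (cases p) auto
qed

lemma sign_zeros_ones: "sign (zeros k @ ones l) = 1"
proof -
  have "sign (ones l) = 1" by (induction l) (auto simp: count_list_replicate)
  then show ?thesis by (induction k) auto
qed

lemma sign_ones_zeros: "sign (ones l @ zeros k) = (-1) ^ (k * l)"
proof -
  have "sign (zeros k) = 1" by (induction k) auto
  then show ?thesis by (induction l) (auto simp: count_list_replicate power_add)
qed

text \<open>The prefix 00 adds no inversion, the prefix 11 adds an even number of them, and the two
  words over each base word of the prism have opposite signs.\<close>

lemma sum_sign_combinations_Suc_Suc_Suc_Suc:
  "sum sign (combinations (Suc (Suc k)) (Suc (Suc l))) =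
     sum sign (combinations k (Suc (Suc l))) + sum sign (combinations (Suc (Suc k)) l)"
proof -
  let ?F = "(\<lambda>w. False # False # w) ` combinations k (Suc (Suc l))"
  let ?T = "(\<lambda>w. True # True # w) ` combinations (Suc (Suc k)) l"
  let ?P = "prism (combinations (Suc k) (Suc l))"
  have fin: "finite ?F" "finite ?T" "finite ?P"
    by (auto simp: finite_combinations prism_def)
  have "sum sign (combinations (Suc (Suc k)) (Suc (Suc l))) = sum sign ?F + sum sign ?P + sum sign ?T"
    unfolding combinations_Suc_Suc_Suc_Suc using fin
    by (subst sum.union_disjoint, auto simp: prism_def mixed_def)+
  also have "sum sign ?F = sum sign (combinations k (Suc (Suc l)))"
    by (subst sum.reindex) (auto simp: inj_on_def)
  also have "sum sign ?T = sum sign (combinations (Suc (Suc k)) l)"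
    by (subst sum.reindex) (auto simp: inj_on_def power_mult_distrib[symmetric] simp flip: mult.assoc)
  also have "sum sign ?P = 0"
    unfolding prism_def
    by (subst sum.UNION_disjoint) (auto simp: finite_combinations mixed_def)
  finally show ?thesis by simp
qed

text \<open>As the only zero moves from the front to the back, the \<open>l + 1\<close> words have
  signs 1, -1, 1, and so on.\<close>

lemma sum_sign_combinations_1_left: "sum sign (combinations (Suc 0) l) = (if even l then 1 else 0)"
proof (induction l)
  case 0
  then show ?case by (simp add: combinations_0_right)
next
  case (Suc l)
  have "sum sign (combinations (Suc 0) (Suc l)) =
     sum sign ((#) False ` combinations 0 (Suc l)) + sum sign ((#) True ` combinations (Suc 0) l)"
    unfolding combinations_Suc_Suc
    by (subst sum.union_disjoint) (auto simp: finite_combinations)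
  also have "sum sign ((#) False ` combinations 0 (Suc l)) = 1"
    using sign_zeros_ones[of 1 "Suc l"] by (simp add: combinations_0_left)
  also have "sum sign ((#) True ` combinations (Suc 0) l) = - sum sign (combinations (Suc 0) l)"
    by (subst sum.reindex) (auto simp: in_combinations_iff sum_negf[symmetric] intro!: sum.cong)
  finally show ?case using Suc by auto
qed

lemma sum_sign_combinations_1_right: "sum sign (combinations k (Suc 0)) = (if even k then 1 else 0)"
proof (induction k)
  case 0
  then show ?case by (simp add: combinations_0_left)
next
  case (Suc k)
  have "sum sign (combinations (Suc k) (Suc 0)) =
     sum sign ((#) False ` combinations k (Suc 0)) + sum sign ((#) True ` combinations (Suc k) 0)"
    unfolding combinations_Suc_Suc
    by (subst sum.union_disjoint) (auto simp: finite_combinations)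
  also have "sum sign ((#) True ` combinations (Suc k) 0) = (-1) ^ Suc k"
    using sign_ones_zeros[of 1 "Suc k"] by (simp add: combinations_0_right)
  also have "sum sign ((#) False ` combinations k (Suc 0)) = sum sign (combinations k (Suc 0))"
    by (subst sum.reindex) auto
  finally show ?case using Suc by auto
qed

text \<open>The recursion lowers a parameter by two, so it preserves the parity condition and ends
  at a parameter 0 or 1.\<close>

lemma sum_sign_combinations_pos:
  assumes "even k \<or> even l"
  shows "1 \<le> sum sign (combinations k l)"
  using assms
proof (induction "k + l" arbitrary: k l rule: less_induct)
  case less
  consider "k = 0" | "l = 0" | "k = Suc 0" | "l = Suc 0" |
    m n where "k = Suc (Suc m)" "l = Suc (Suc n)"
    by (metis not0_implies_Suc)
  then show ?case
  proof cases
    case 1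
    then show ?thesis using sign_zeros_ones[of 0 l] by (simp add: combinations_0_left)
  next
    case 2
    then show ?thesis using sign_zeros_ones[of k 0] by (simp add: combinations_0_right)
  next
    case 5
    then show ?thesis
      using less.hyps[of m l] less.hyps[of k n] less.prems
      by (simp add: sum_sign_combinations_Suc_Suc_Suc_Suc)
  qed (use less.prems in \<open>auto simp: sum_sign_combinations_1_left sum_sign_combinations_1_right\<close>)
qed

lemma no_ham_path_combinations:
  assumes "2 \<le> k" "2 \<le> l" "even k \<or> even l"
  shows "\<not> ham_path adj (combinations k l) x y"
proof
  assume "ham_path adj (combinations k l) x y"
  then obtain p where p: "distinct p" "set p = combinations k l" "successively adj p"
    unfolding ham_path_def by blast
  have "sum sign (combinations k l) = (\<Sum>w\<leftarrow>p. sign w)"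
    using p by (simp add: sum_list_distinct_conv_sum_set)
  then have "sum sign (combinations k l) \<le> 1"
    using abs_sum_list_sign[OF p(3)] by linarith
  \<comment> \<open>The sum splits into the sums for \<open>(m, l)\<close> and
    \<open>(k, n)\<close>. Parities are unchanged, so each is at least 1 and the total is at least
    2.\<close>
  moreover obtain m n where mn: "k = Suc (Suc m)" "l = Suc (Suc n)"
    using assms(1,2) by (metis Suc_le_D numeral_2_eq_2 Suc_le_mono)
  ultimately show False
    using sum_sign_combinations_pos[of m l] sum_sign_combinations_pos[of k n] assms(3)
    by (simp add: sum_sign_combinations_Suc_Suc_Suc_Suc)
qed


section \<open>Hamilton paths in the graph of combinations\<close>

text \<open>The graph is itself a path: the only zero travels from the front to the back.\<close>

lemma ham_path_combinations_1_left:
  "ham_path adj (combinations (Suc 0) l) (False # ones l) (ones l @ [False])"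
proof (induction l)
  case 0
  then show ?case by (simp add: combinations_0_right ham_path_singleton)
next
  case (Suc l)
  have "ham_path adj ((#) True ` combinations (Suc 0) l) (True # False # ones l) (True # ones l @ [False])"
    by (rule ham_path_image[OF Suc]) (auto simp: adj_Cons)
  then have "ham_path adj ({False # ones (Suc l)} \<union> (#) True ` combinations (Suc 0) l)
      (False # ones (Suc l)) (True # ones l @ [False])"
    by (intro ham_path_join[OF ham_path_singleton]) (auto simp: adj_Cons)
  then show ?case
    by (simp add: combinations_Suc_Suc combinations_0_left)
qed

lemma ham_path_combinations_1_right:
  "ham_path adj (combinations k (Suc 0)) (zeros k @ [True]) (True # zeros k)"
proof (induction k)
  case 0
  then show ?case by (simp add: combinations_0_left ham_path_singleton)
next
  case (Suc k)
  have "ham_path adj ((#) False ` combinations k (Suc 0)) (False # zeros k @ [True]) (False # True # zeros k)"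
    by (rule ham_path_image[OF Suc]) (auto simp: adj_Cons)
  then have "ham_path adj ((#) False ` combinations k (Suc 0) \<union> {True # zeros (Suc k)})
      (False # zeros k @ [True]) (True # zeros (Suc k))"
    by (rule ham_path_join[OF _ ham_path_singleton]) (auto simp: adj_Cons)
  then show ?case
    by (simp add: combinations_Suc_Suc combinations_0_right)
qed

section \<open>The statements of the joint induction for odd and even parameters\<close>

definition odd_path :: "nat \<Rightarrow> nat \<Rightarrow> bool" where
  "odd_path k l \<longleftrightarrow> ham_path adj (combinations k l) (zeros k @ ones l) (ones l @ zeros k)"

text \<open>Both ends of each path lie over the same sorted word, so the path can replace the direct
  edge over a neighbour of that word, as in \<open>ham_path_detour\<close>. One sorted word is
  needed for the insertion at prefix 00, the other for prefix 11.\<close>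

definition even_paths :: "nat \<Rightarrow> nat \<Rightarrow> bool" where
  "even_paths k l \<longleftrightarrow>
     ham_path adj (prism (combinations k l)) (mixed True (ones l @ zeros k)) (mixed False (ones l @ zeros k)) \<and>
     ham_path adj (prism (combinations k l)) (mixed True (zeros k @ ones l)) (mixed False (zeros k @ ones l))"

lemma ham_path_prism_lift:
  assumes "ham_path adj (prism S) (mixed c v) (mixed d w)"
    and "inj f" "\<And>u v. adj u v \<Longrightarrow> adj (f u) (f v)"
  shows "ham_path adj (prism (f ` S)) (mixed c (f v)) (mixed d (f w))"
proof -
  \<comment> \<open>The map \<open>g\<close> keeps the two bits that name the copy and applies
    \<open>f\<close> to the rest.\<close>
  define g where "g u = take 2 u @ f (drop 2 u)" for u
  have g [simp]: "g (mixed c u) = mixed c (f u)" for c u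
    by (simp add: g_def mixed_def)
  have "g ` prism S = prism (f ` S)"
    by (auto simp: prism_def image_UN)
  moreover have "ham_path adj (g ` prism S) (g (mixed c v)) (g (mixed d w))"
  proof (rule ham_path_image[OF assms(1)])
    show "inj_on g (prism S)"
      using assms(2) by (auto simp: inj_on_def elim!: in_prismE)
  next
    fix u v assume "u \<in> prism S" "v \<in> prism S" "adj u v"
    then show "adj (g u) (g v)"
      using assms(3) by (auto simp: adj_mixed elim!: in_prismE split: if_splits)
  qed
  ultimately show ?thesis by simp
qed

text \<open>Since \<open>g\<close> and \<open>h\<close> are adjacent, both copies of
  \<open>g\<close> are adjacent to the corresponding copies of \<open>h\<close>: step over in one
  copy, follow the given path, and step back in the other.\<close>

lemma ham_path_detour:
  assumes "ham_path adj (prism S) (mixed True h) (mixed False h)" "adj g h" "g \<notin> S"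
  shows "ham_path adj ({mixed True g, mixed False g} \<union> prism S) (mixed True g) (mixed False g)"
proof -
  have "ham_path adj ({mixed True g} \<union> prism S) (mixed True g) (mixed False h)"
    using assms by (intro ham_path_join[OF ham_path_singleton]) (auto simp: adj_mixed)
  then have "ham_path adj (({mixed True g} \<union> prism S) \<union> {mixed False g}) (mixed True g) (mixed False g)"
    using assms sympD[OF symp_adj]
    by (intro ham_path_join[OF _ ham_path_singleton]) (auto simp: adj_mixed)
  then show ?thesis
    by (simp add: insert_commute Un_commute)
qed

section \<open>The prism over \<open>C(P+2,Q+2)\<close> for even \<open>P\<close> and
  \<open>Q\<close>\<close>

context
  fixes P Q :: nat
  assumes odd: "odd_path (Suc P) (Suc Q)" and even_PQ: "even P" "even Q"
    and even_left: "even_paths P (Suc (Suc Q))" and even_right: "even_paths (Suc (Suc P)) Q"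
begin

text \<open>
  The prism over \<open>C(P+2,Q+2)\<close> consists of rungs, the edges between \<open>mixed True g\<close> and \<open>mixed False g\<close>.
  The rungs over \<open>g \<in> prism (C(P+1,Q+1))\<close> are arranged along a Hamilton path of that ladder, and the
  prisms over the words that start with \<open>00\<close> and \<open>11\<close> are inserted as detours into one rung each.
\<close>

definition rung :: "bool list \<Rightarrow> bool list set" where
  "rung g = {mixed True g, mixed False g} \<union>
     (if g = mixed False (False # ones (Suc Q) @ zeros P)
      then prism ((\<lambda>w. False # False # w) ` combinations P (Suc (Suc Q))) else {}) \<union>
     (if g = mixed True (True # zeros (Suc P) @ ones Q)
      then prism ((\<lambda>w. True # True # w) ` combinations (Suc (Suc P)) Q) else {})"

lemma ham_path_rung: "ham_path adj (rung g) (mixed True g) (mixed False g)"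
proof -
  let ?u = "mixed False (False # ones (Suc Q) @ zeros P)"
  let ?w = "mixed True (True # zeros (Suc P) @ ones Q)"
  consider "g = ?u" | "g = ?w" | "g \<noteq> ?u" "g \<noteq> ?w" by blast
  then show ?thesis
  proof cases
    case 1
    \<comment> \<open>The detour sits over \<open>00 1^(Q+2) 0^P\<close>, which becomes
      \<open>?u\<close>, the word \<open>01 0 1^(Q+1) 0^P\<close>, by exchanging the second and
      third bits. The next case exchanges the same bits of \<open>11 0^(P+2) 1^Q\<close>.\<close>
    have "ham_path adj (prism ((\<lambda>w. False # False # w) ` combinations P (Suc (Suc Q))))
      (mixed True (False # False # ones (Suc (Suc Q)) @ zeros P))
      (mixed False (False # False # ones (Suc (Suc Q)) @ zeros P))"
      using even_left unfolding even_paths_def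
      by (intro ham_path_prism_lift[where f = "\<lambda>w. False # False # w"]) (auto simp: inj_def adj_Cons)
    from ham_path_detour[OF this, of ?u] show ?thesis
      using 1 by (auto simp: rung_def mixed_def adj_Cons)
  next
    case 2
    have "ham_path adj (prism ((\<lambda>w. True # True # w) ` combinations (Suc (Suc P)) Q))
      (mixed True (True # True # zeros (Suc (Suc P)) @ ones Q))
      (mixed False (True # True # zeros (Suc (Suc P)) @ ones Q))"
      using even_right unfolding even_paths_def
      by (intro ham_path_prism_lift[where f = "\<lambda>w. True # True # w"]) (auto simp: inj_def adj_Cons)
    from ham_path_detour[OF this, of ?w] show ?thesis
      using 2 by (auto simp: rung_def mixed_def adj_Cons)
  next
    case 3
    then have "rung g = {mixed True g, mixed False g}"
      unfolding rung_def by auto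
    then show ?thesis
      by (simp add: ham_path_pair adj_mixed)
  qed
qed

lemma rung_disjoint: "g \<in> prism A \<Longrightarrow> h \<in> prism A \<Longrightarrow> g \<noteq> h \<Longrightarrow> rung g \<inter> rung h = {}"
  unfolding rung_def by (auto elim!: in_prismE simp: mixed_def split: if_splits)

lemma UN_rung:
  "(\<Union>g\<in>prism (combinations (Suc P) (Suc Q)). rung g) = prism (combinations (Suc (Suc P)) (Suc (Suc Q)))"
proof -
  \<comment> \<open>Both words that carry a detour occur in the ladder, so the words with prefix 00
    and 11 are all covered.\<close>
  have "mixed False (False # ones (Suc Q) @ zeros P) \<in> prism (combinations (Suc P) (Suc Q))"
    "mixed True (True # zeros (Suc P) @ ones Q) \<in> prism (combinations (Suc P) (Suc Q))"
    by (auto simp: in_combinations_iff count_list_replicate)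
  then show ?thesis
    unfolding combinations_Suc_Suc_Suc_Suc rung_def
    by (auto simp: prism_def split: if_splits)
qed

text \<open>A prism has an even number of vertices, so the zigzag over its rungs ends on the side
  \<open>c\<close> on which it began.\<close>

lemma ham_path_rungs:
  assumes "ham_path adj (prism S) x y"
  shows "ham_path adj (\<Union>g\<in>prism S. rung g) (mixed c x) (mixed c y)"
proof -
  obtain gs where gs: "gs \<noteq> []" "distinct gs" "set gs = prism S" "successively adj gs" "hd gs = x" "last gs = y"
    using assms unfolding ham_path_def by blast
  have "finite S"
  proof -
    have "S \<subseteq> drop 2 ` prism S"
      by (auto simp: prism_def mixed_def image_UN)
    then show ?thesis
      using gs(3) by (metis finite_imageI finite_set finite_subset)
  qed
  then have "even (length gs)"
    using gs(2,3) card_prism by (metis distinct_card dvd_triv_left)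
  moreover have "ham_path adj (\<Union>g\<in>set gs. rung g) (mixed c (hd gs)) (mixed (c = even (length gs)) (last gs))"
    using gs ham_path_rung rung_disjoint
    by (intro ham_path_zigzag symp_adj) (auto simp: adj_mixed)
  ultimately show ?thesis
    using gs by simp
qed

text \<open>Running the path for odd parameters forward in one copy of \<open>?C\<close> and
  backward in the other gives a Hamilton path of the ladder between the two copies of
  \<open>?s\<close>. Arranging the rungs along it leads to ends that are again adjacent, which
  closes the cycle.\<close>

lemma ham_cycle_even: "ham_cycle adj (prism (combinations (Suc (Suc P)) (Suc (Suc Q))))"
proof -
  let ?C = "combinations (Suc P) (Suc Q)"
  let ?s = "zeros (Suc P) @ ones (Suc Q)" and ?t = "ones (Suc Q) @ zeros (Suc P)"
  have lift: "ham_path adj (mixed c ` ?C) (mixed c ?s) (mixed c ?t)" for c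
    using odd unfolding odd_path_def
    by (rule ham_path_image) (auto simp: adj_mixed inj_on_def)
  have "ham_path adj (mixed False ` ?C \<union> mixed True ` ?C) (mixed False ?s) (mixed True ?s)"
    by (rule ham_path_join[OF lift ham_path_rev[OF symp_adj lift]]) (auto simp: adj_mixed)
  moreover have "mixed False ` ?C \<union> mixed True ` ?C = prism ?C"
    by (auto simp: prism_def)
  ultimately have "ham_path adj (prism ?C) (mixed False ?s) (mixed True ?s)"
    by simp
  from ham_path_rungs[OF this, of True]
  have path: "ham_path adj (prism (combinations (Suc (Suc P)) (Suc (Suc Q))))
      (mixed True (mixed False ?s)) (mixed True (mixed True ?s))"
    by (simp add: UN_rung)
  have card: "3 \<le> card (prism (combinations (Suc (Suc P)) (Suc (Suc Q))))"
  proof -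
    have "{mixed True ?s, mixed False ?s} \<subseteq> combinations (Suc (Suc P)) (Suc (Suc Q))"
      by (auto simp: in_combinations_iff count_list_replicate mixed_def)
    from card_mono[OF finite_combinations this] show ?thesis
      by (simp add: card_prism finite_combinations)
  qed
  show ?thesis
    by (rule ham_cycleI[OF path _ card]) (simp add: adj_mixed)
qed

text \<open>The end words have degree 2 in the prism, hence their rungs lie on every Hamilton cycle.\<close>

lemma even_paths_step: "even_paths (Suc (Suc P)) (Suc (Suc Q))"
proof -
  let ?S = "combinations (Suc (Suc P)) (Suc (Suc Q))"
  have *: "ham_path adj (prism ?S) (mixed True x) (mixed False x)"
    if x: "x \<in> ?S" and n: "\<And>y. adj x y \<Longrightarrow> y = z" for x z
  proof -
    have nb: "v = mixed False x \<or> v = mixed True z" if "v \<in> prism ?S" "adj (mixed True x) v" for v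
      using that n by (auto simp: adj_mixed elim!: in_prismE split: if_splits)
    obtain m n where "m \<noteq> n" "m \<in> prism ?S" "n \<in> prism ?S" "adj (mixed True x) m" "adj (mixed True x) n"
      "ham_path adj (prism ?S) (mixed True x) m" "ham_path adj (prism ?S) (mixed True x) n"
      using ham_cycle_neighbours[OF symp_adj ham_cycle_even, of "mixed True x"] x by auto
    \<comment> \<open>The neighbours \<open>m\<close> and \<open>n\<close> are distinct and there
      are only two candidates, so one of them is \<open>mixed False x\<close>, and the path ending
      there is the required one.\<close>
    then show ?thesis
      using nb by metis
  qed
  show ?thesis
    unfolding even_paths_def
    by (intro conjI *) (auto simp: in_combinations_iff count_list_replicate
      simp del: replicate_Suc dest: adj_ones_zeros adj_zeros_ones)
qed

text \<open>Unlike \<open>even_paths\<close>, this path has its ends over different words, as needed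
  to connect the words with prefix 00 to those with prefix 11. The ladder over \<open>?t\<close> is
  treated separately to correct the parity of the zigzag.\<close>

lemma ham_path_even:
  "ham_path adj (prism (combinations (Suc (Suc P)) (Suc (Suc Q))))
     (mixed False (mixed False (ones (Suc Q) @ zeros (Suc P))))
     (mixed True (mixed True (zeros (Suc P) @ ones (Suc Q))))"
proof -
  let ?C = "combinations (Suc P) (Suc Q)"
  let ?s = "zeros (Suc P) @ ones (Suc Q)" and ?t = "ones (Suc Q) @ zeros (Suc P)"
  obtain h where h: "h \<noteq> []" "distinct h" "set h = ?C" "successively adj h" "hd h = ?t" "last h = ?s"
    using ham_path_rev[OF symp_adj odd[unfolded odd_path_def]] unfolding ham_path_def by blast
  \<comment> \<open>The words \<open>?t\<close> and \<open>?s\<close> have opposite signs because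
    \<open>(P + 1) * (Q + 1)\<close> is odd, so \<open>h\<close> has an even number of vertices and
    its tail \<open>hs\<close> an odd number.\<close>
  have "(-1 :: int) ^ (length h - 1) = -1"
    using sign_last[OF h(1,4)] sign_zeros_ones[of "Suc P" "Suc Q"] sign_ones_zeros[of "Suc Q" "Suc P"]
      even_PQ h(5,6) by (simp del: replicate_Suc sign.simps replicate_append_same)
  then have "odd (length h - 1)"
    by (auto simp: minus_one_power_iff split: if_splits)
  moreover obtain hs where hs: "h = ?t # hs"
    using h(1,5) by (cases h) auto
  ultimately have "odd (length hs)" by simp
  then have "hs \<noteq> []" by auto
  have hs': "distinct hs" "?t \<notin> set hs" "successively adj hs" "last hs = ?s" "adj ?t (hd hs)"
    "?C = insert ?t (set hs)"
    using h \<open>hs \<noteq> []\<close> unfolding hs by (auto simp: successively_Cons)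
  have "ham_path adj (\<Union>g\<in>set hs. {mixed True g, mixed False g}) (mixed False (hd hs))
      (mixed (False = even (length hs)) (last hs))"
    using hs' \<open>hs \<noteq> []\<close> by (intro ham_path_zigzag symp_adj ham_path_pair) (auto simp: adj_mixed)
  then have "ham_path adj (prism (set hs)) (mixed False (hd hs)) (mixed True ?s)"
    using hs' \<open>odd (length hs)\<close> by (simp add: prism_def)
  note tail = ham_path_rungs[OF this, of True]
  \<comment> \<open>The two ends of this rung are visited separately, before and after the whole
    rung over \<open>mixed True ?t\<close>, so it must carry no detour. The rung over
    \<open>mixed True ?t\<close> may carry one, namely if \<open>Q = 0\<close>.\<close>
  have thin: "rung (mixed False ?t) = {mixed True (mixed False ?t), mixed False (mixed False ?t)}"
    by (auto simp: rung_def)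
  have "ham_path adj ({mixed False (mixed False ?t)} \<union> rung (mixed True ?t))
      (mixed False (mixed False ?t)) (mixed True (mixed True ?t))"
    using rung_disjoint[of "mixed False ?t" UNIV "mixed True ?t"] thin
    by (intro ham_path_join[OF ham_path_singleton ham_path_rev[OF symp_adj ham_path_rung]])
      (auto simp: adj_mixed)
  then have "ham_path adj (({mixed False (mixed False ?t)} \<union> rung (mixed True ?t)) \<union> {mixed True (mixed False ?t)})
      (mixed False (mixed False ?t)) (mixed True (mixed False ?t))"
    using rung_disjoint[of "mixed False ?t" UNIV "mixed True ?t"] thin
    by (intro ham_path_join[OF _ ham_path_singleton]) (auto simp: adj_mixed)
  then have "ham_path adj (rung (mixed False ?t) \<union> rung (mixed True ?t))
      (mixed False (mixed False ?t)) (mixed True (mixed False ?t))"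
    unfolding thin by (simp add: insert_commute)
  then have "ham_path adj ((rung (mixed False ?t) \<union> rung (mixed True ?t)) \<union> (\<Union>g\<in>prism (set hs). rung g))
      (mixed False (mixed False ?t)) (mixed True (mixed True ?s))"
  proof (rule ham_path_join[OF _ tail])
    show "adj (mixed True (mixed False ?t)) (mixed True (mixed False (hd hs)))"
      using hs' by (simp add: adj_mixed)
    have "rung (mixed c ?t) \<inter> rung g = {}" if "g \<in> prism (set hs)" for c g
      using that hs'(2) by (intro rung_disjoint[of _ UNIV]) (auto elim!: in_prismE)
    then show "(rung (mixed False ?t) \<union> rung (mixed True ?t)) \<inter> (\<Union>g\<in>prism (set hs). rung g) = {}"
      by blast
  qed
  moreover have "(rung (mixed False ?t) \<union> rung (mixed True ?t)) \<union> (\<Union>g\<in>prism (set hs). rung g) =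
      (\<Union>g\<in>prism ?C. rung g)"
    unfolding hs'(6) by (auto simp: prism_def)
  ultimately show ?thesis
    by (simp add: UN_rung)
qed

end

text \<open>Both links exchange the second and third bits: \<open>00 11\<close> followed by
  \<open>1^(Q+1) 0^(P+1)\<close> becomes \<open>01 01\<close> with the same rest, and
  \<open>10 10\<close> followed by \<open>0^(P+1) 1^(Q+1)\<close> becomes
  \<open>11 00\<close>.\<close>

lemma odd_path_step:
  assumes "odd_path (Suc P) (Suc Q)" "even P" "even Q"
    and "even_paths P (Suc (Suc Q))" "even_paths (Suc (Suc P)) Q"
    and left: "odd_path (Suc P) (Suc (Suc (Suc Q)))" and right: "odd_path (Suc (Suc (Suc P))) (Suc Q)"
  shows "odd_path (Suc (Suc (Suc P))) (Suc (Suc (Suc Q)))"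
proof -
  let ?F = "(\<lambda>w. False # False # w) ` combinations (Suc P) (Suc (Suc (Suc Q)))"
  let ?T = "(\<lambda>w. True # True # w) ` combinations (Suc (Suc (Suc P))) (Suc Q)"
  let ?M = "prism (combinations (Suc (Suc P)) (Suc (Suc Q)))"
  have F: "ham_path adj ?F (False # False # zeros (Suc P) @ ones (Suc (Suc (Suc Q))))
      (False # False # ones (Suc (Suc (Suc Q))) @ zeros (Suc P))"
    using left unfolding odd_path_def by (rule ham_path_image) (auto simp: adj_Cons inj_on_def)
  have T: "ham_path adj ?T (True # True # zeros (Suc (Suc (Suc P))) @ ones (Suc Q))
      (True # True # ones (Suc Q) @ zeros (Suc (Suc (Suc P))))"
    using right unfolding odd_path_def by (rule ham_path_image) (auto simp: adj_Cons inj_on_def)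
  have "ham_path adj (?F \<union> ?M) (False # False # zeros (Suc P) @ ones (Suc (Suc (Suc Q))))
     (mixed True (mixed True (zeros (Suc P) @ ones (Suc Q))))"
    by (rule ham_path_join[OF F ham_path_even[OF assms(1-5)]]) (auto simp: adj_Cons mixed_def prism_def)
  then have "ham_path adj ((?F \<union> ?M) \<union> ?T) (False # False # zeros (Suc P) @ ones (Suc (Suc (Suc Q))))
      (True # True # ones (Suc Q) @ zeros (Suc (Suc (Suc P))))"
    by (rule ham_path_join[OF _ T]) (auto simp: adj_Cons mixed_def prism_def)
  then show ?thesis
    unfolding odd_path_def combinations_Suc_Suc_Suc_Suc[of "Suc P" "Suc Q"] by simp
qed

text \<open>The two claims are proved together because each step needs both of them for a smaller
  \<open>k + l\<close>. The base cases are a parameter 1 in the odd claim and 0 in the even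
  one.\<close>

lemma odd_path_even_paths:
  "(odd k \<and> odd l \<longrightarrow> odd_path k l) \<and> (even k \<and> even l \<longrightarrow> even_paths k l)"
proof (induction "k + l" arbitrary: k l rule: less_induct)
  case less
  have IHo: "odd_path k' l'" if "k' + l' < k + l" "odd k'" "odd l'" for k' l'
    using less that by blast
  have IHe: "even_paths k' l'" if "k' + l' < k + l" "even k'" "even l'" for k' l'
    using less that by blast
  have "odd_path k l" if kl: "odd k" "odd l"
  proof -
    consider "k = Suc 0" | "l = Suc 0" | P Q where "k = Suc (Suc (Suc P))" "l = Suc (Suc (Suc Q))"
      using kl by (metis even_Suc even_zero not0_implies_Suc)
    then show ?thesis
    proof cases
      case 3
      show ?thesis
        unfolding 3 using kl by (intro odd_path_step IHo IHe) (auto simp: 3)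
    qed (use ham_path_combinations_1_left[of l] ham_path_combinations_1_right[of k] in
      \<open>auto simp: odd_path_def\<close>)
  qed
  moreover have "even_paths k l" if kl: "even k" "even l"
  proof -
    have triv: "ham_path adj (prism {w}) (mixed True w) (mixed False w)" for w
      by (simp add: prism_def ham_path_pair adj_mixed)
    consider "k = 0" | "l = 0" | P Q where "k = Suc (Suc P)" "l = Suc (Suc Q)"
      using kl by (metis even_Suc even_zero not0_implies_Suc)
    then show ?thesis
    proof cases
      case 3
      show ?thesis
        unfolding 3 using kl by (intro even_paths_step IHo IHe) (auto simp: 3)
    qed (auto simp: even_paths_def combinations_0_left combinations_0_right triv)
  qed
  ultimately show ?case by blast
qed

theorem ham_path_combinations_iff:
  "(\<exists>x y. ham_path adj (combinations k l) x y) \<longleftrightarrow> k \<le> 1 \<or> l \<le> 1 \<or> (odd k \<and> odd l)"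
proof
  assume "\<exists>x y. ham_path adj (combinations k l) x y"
  then show "k \<le> 1 \<or> l \<le> 1 \<or> (odd k \<and> odd l)"
    using no_ham_path_combinations[of k l] by fastforce
next
  assume "k \<le> 1 \<or> l \<le> 1 \<or> (odd k \<and> odd l)"
  then consider "k = 0" | "l = 0" | "k = Suc 0" | "l = Suc 0" | "odd k" "odd l"
    by fastforce
  then show "\<exists>x y. ham_path adj (combinations k l) x y"
  proof cases
    case 5
    then show ?thesis using odd_path_even_paths[of k l] unfolding odd_path_def by blast
  qed (use ham_path_combinations_1_left ham_path_combinations_1_right
        ham_path_singleton[of adj "ones l"] ham_path_singleton[of adj "zeros k"] in
      \<open>auto simp: combinations_0_left combinations_0_right\<close>)
qed

theorem no_ham_cycle_combinations:
  "\<not> ham_cycle adj (combinations k l)"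
proof
  assume "ham_cycle adj (combinations k l)"
  moreover have "zeros k @ ones l \<in> combinations k l"
    by (simp add: in_combinations_iff count_list_replicate)
  ultimately show False
    using ham_cycle_neighbours[OF symp_adj] adj_zeros_ones by metis
qed


section \<open>Segments of a convex polygon\<close>

lemma side_iff:
  assumes "p < q" "3 \<le> N"
  shows "{p, q} \<in> polygon_sides N \<longleftrightarrow> 1 \<le> p \<and> q \<le> N \<and> (q = Suc p \<or> p = 1 \<and> q = N)"
  using assms by (auto simp: polygon_sides_def doubleton_eq_iff)

lemma diagonal_iff:
  assumes "p < q" "3 \<le> N"
  shows "{p, q} \<in> diagonals N \<longleftrightarrow> 1 \<le> p \<and> q \<le> N \<and> q \<noteq> Suc p \<and> \<not> (p = 1 \<and> q = N)"
proof -
  have "{p, q} \<in> {{i, j} | i j. i \<in> {1..N} \<and> j \<in> {1..N} \<and> i \<noteq> j} \<longleftrightarrow> 1 \<le> p \<and> q \<le> N"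
    using assms(1) by (fastforce simp: doubleton_eq_iff)
  then show ?thesis
    unfolding diagonals_def using side_iff[OF assms] by auto
qed

lemma diagonalE:
  assumes "d \<in> diagonals N"
  obtains p q where "d = {p, q}" "p < q" "1 \<le> p" "q \<le> N"
proof -
  obtain i j where "d = {i, j}" "i \<in> {1..N}" "j \<in> {1..N}" "i \<noteq> j"
    using assms by (auto simp: diagonals_def)
  then show thesis
    using that[of i j] that[of j i] by (cases "i < j") (auto simp: insert_commute)
qed

lemma crossing_iff:
  assumes "p < q" "r < s"
  shows "crossing {p, q} {r, s} \<longleftrightarrow> p < r \<and> r < q \<and> q < s \<or> r < p \<and> p < s \<and> s < q"
proof
  assume "crossing {p, q} {r, s}"
  then obtain i j k l where *: "i < j" "j < k" "k < l" "{{p, q}, {r, s}} = {{i, k}, {j, l}}"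
    unfolding crossing_def by blast
  then have "{p, q} = {i, k} \<and> {r, s} = {j, l} \<or> {p, q} = {j, l} \<and> {r, s} = {i, k}"
    by (auto simp: doubleton_eq_iff)
  then show "p < r \<and> r < q \<and> q < s \<or> r < p \<and> p < s \<and> s < q"
    using *(1-3) assms by (auto simp: doubleton_eq_iff)
next
  assume "p < r \<and> r < q \<and> q < s \<or> r < p \<and> p < s \<and> s < q"
  then show "crossing {p, q} {r, s}"
  proof
    assume "p < r \<and> r < q \<and> q < s"
    then show ?thesis
      unfolding crossing_def by blast
  next
    assume "r < p \<and> p < s \<and> s < q"
    then show ?thesis
      unfolding crossing_def by (intro exI[of _ r] exI[of _ p] exI[of _ s] exI[of _ q]) auto
  qed
qed

lemma trianglesI:
  assumes "p \<noteq> q" "q \<noteq> r" "p \<noteq> r"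
    and "{p, q} \<in> polygon_sides N \<union> T" "{q, r} \<in> polygon_sides N \<union> T" "{p, r} \<in> polygon_sides N \<union> T"
  shows "{p, q, r} \<in> triangles N T"
  unfolding triangles_def using assms by blast

lemma trianglesE:
  assumes "t \<in> triangles N T"
  obtains p q r where "t = {p, q, r}" "p \<noteq> q" "q \<noteq> r" "p \<noteq> r"
    "{p, q} \<in> polygon_sides N \<union> T" "{q, r} \<in> polygon_sides N \<union> T" "{p, r} \<in> polygon_sides N \<union> T"
proof -
  obtain p q r where "t = {p, q, r}" "p \<noteq> q \<and> q \<noteq> r \<and> p \<noteq> r"
    "{{p, q}, {q, r}, {p, r}} \<subseteq> polygon_sides N \<union> T"
    using assms unfolding triangles_def by blast
  then show thesis by (intro that[of p q r]) auto
qed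

lemma flipI:
  assumes "{p, q} \<in> T" "p \<noteq> q" "r \<noteq> s" "r \<notin> {p, q}" "s \<notin> {p, q}"
    and "{p, r} \<in> polygon_sides N \<union> T" "{q, r} \<in> polygon_sides N \<union> T"
    and "{p, s} \<in> polygon_sides N \<union> T" "{q, s} \<in> polygon_sides N \<union> T"
  shows "flip N T (T - {{p, q}} \<union> {{r, s}})"
proof -
  have "{p, q, r} \<in> triangles N T" "{p, q, s} \<in> triangles N T"
    using assms by (auto intro!: trianglesI)
  with assms(1,3) show ?thesis
    unfolding flip_def by blast
qed

text \<open>Take for \<open>k\<close> the last point before \<open>j\<close> that is joined to
  \<open>i\<close>. If \<open>{k, j}\<close> were missing, maximality would give a segment of
  \<open>T\<close> crossing it. This segment crosses neither \<open>{i, j}\<close> nor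
  \<open>{i, k}\<close>, so it starts at \<open>i\<close> and ends beyond \<open>k\<close>, against
  the choice of \<open>k\<close>.\<close>

lemma triangulation_triangle_below:
  assumes "triangulation N T" "3 \<le> N" "{i, j} \<in> T" "i < j"
  obtains k where "i < k" "k < j" "{i, j, k} \<in> triangles N T"
proof -
  have diag: "T \<subseteq> diagonals N" and nc: "\<And>e f. e \<in> T \<Longrightarrow> f \<in> T \<Longrightarrow> \<not> crossing e f"
    and maximal: "\<And>d. d \<in> diagonals N \<Longrightarrow> d \<notin> T \<Longrightarrow> \<exists>e\<in>T. crossing d e"
    using assms(1) unfolding triangulation_def by auto
  have ij: "1 \<le> i" "j \<le> N" "j \<noteq> Suc i"
    using diag assms by (auto simp: diagonal_iff)
  let ?K = "{k. i < k \<and> k < j \<and> {i, k} \<in> polygon_sides N \<union> T}"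
  define k where "k = Max ?K"
  have "finite ?K" by (rule finite_subset[of _ "{..j}"]) auto
  moreover have "Suc i \<in> ?K"
    using ij assms by (auto simp: side_iff)
  ultimately have "k \<in> ?K"
    unfolding k_def by (intro Max_in) auto
  have k_max: "u \<le> k" if "u \<in> ?K" for u
    unfolding k_def using \<open>finite ?K\<close> that by (rule Max_ge)
  from \<open>k \<in> ?K\<close> have k: "i < k" "k < j" "{i, k} \<in> polygon_sides N \<union> T" by auto
  have "{k, j} \<in> polygon_sides N \<union> T"
  proof (rule ccontr)
    assume not: "{k, j} \<notin> polygon_sides N \<union> T"
    then have "{k, j} \<in> diagonals N"
      using k ij assms(2) by (auto simp: diagonal_iff side_iff)
    then obtain e where e: "e \<in> T" "crossing {k, j} e"
      using maximal not by blast
    obtain u v where uv: "e = {u, v}" "u < v"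
      using e(1) diag by (meson diagonalE subsetD)
    have "k < u \<and> u < j \<and> j < v \<or> u < k \<and> k < v \<and> v < j"
      using e(2) uv k(2) by (simp add: crossing_iff)
    moreover have "\<not> (i < u \<and> u < j \<and> j < v)" "\<not> (u < i \<and> i < v \<and> v < j)"
      using nc[OF assms(3) e(1)] uv assms(4) by (auto simp: crossing_iff)
    ultimately have u: "i \<le> u" "u < k" "k < v" "v < j"
      using k by auto
    have "u = i"
    proof (rule ccontr)
      assume "u \<noteq> i"
      with u k(3) have "{i, k} \<in> T"
        using assms(2) k ij by (auto simp: side_iff)
      with nc[OF this e(1)] uv u \<open>u \<noteq> i\<close> k(1) show False
        by (simp add: crossing_iff)
    qed
    then have "v \<in> ?K"
      using u uv e(1) k by auto
    from k_max[OF this] u show False by simp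
  qed
  then have "{i, j, k} \<in> triangles N T"
    using assms k by (intro trianglesI) (auto simp: insert_commute)
  with k that show thesis by blast
qed


section \<open>Lattice paths\<close>

definition lattice_point :: "bool list \<Rightarrow> nat \<Rightarrow> nat \<times> nat" where
  "lattice_point w i = (count_list (take i w) False, count_list (take i w) True)"

lemma lattice_point_0: "lattice_point w 0 = (0, 0)"
  by (simp add: lattice_point_def)

lemma lattice_point_length: "w \<in> combinations k l \<Longrightarrow> lattice_point w (length w) = (k, l)"
  by (simp add: lattice_point_def in_combinations_iff)

lemma length_combinations: "w \<in> combinations k l \<Longrightarrow> length w = k + l"
  by (simp add: combinations_def)

lemma lattice_point_level: "i \<le> length w \<Longrightarrow> fst (lattice_point w i) + snd (lattice_point w i) = i"
  using length_eq_count_list[of "take i w"] by (simp add: lattice_point_def)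

lemma lattice_point_mono:
  assumes "i \<le> j"
  shows "fst (lattice_point w i) \<le> fst (lattice_point w j)" "snd (lattice_point w i) \<le> snd (lattice_point w j)"
proof -
  have "take j w = take i w @ take (j - i) (drop i w)"
    using assms by (metis le_add_diff_inverse take_add)
  then show "fst (lattice_point w i) \<le> fst (lattice_point w j)" "snd (lattice_point w i) \<le> snd (lattice_point w j)"
    by (simp_all add: lattice_point_def)
qed

lemma lattice_point_Suc:
  assumes "i < length w"
  shows "lattice_point w (Suc i) =
    (fst (lattice_point w i) + (if w ! i then 0 else 1), snd (lattice_point w i) + (if w ! i then 1 else 0))"
  using assms by (simp add: lattice_point_def take_Suc_conv_app_nth)

lemma lattice_point_le:
  assumes "w \<in> combinations k l" "i \<le> length w"
  shows "fst (lattice_point w i) \<le> k" "snd (lattice_point w i) \<le> l"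
  using lattice_point_mono[OF assms(2), of w] lattice_point_length[OF assms(1)] by simp_all

lemma lattice_point_eq_imp_nth_eq:
  assumes "i < length v" "i < length w" "lattice_point v i = lattice_point w i"
    "lattice_point v (Suc i) = lattice_point w (Suc i)"
  shows "v ! i = w ! i"
  using assms by (auto simp: lattice_point_Suc split: if_splits)

text \<open>A discrete intermediate value argument: each step raises the coordinate by at most
  one.\<close>

lemma lattice_path_fst_onto:
  assumes "w \<in> combinations k l" "x \<le> k"
  obtains i where "i \<le> length w" "fst (lattice_point w i) = x"
proof -
  have "\<exists>i \<le> n. fst (lattice_point w i) = x" if "n \<le> length w" "x \<le> fst (lattice_point w n)" for n
    using that
  proof (induction n)
    case (Suc n)
    show ?case
    proof (cases "x \<le> fst (lattice_point w n)")
      case True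
      then show ?thesis using Suc by (meson Suc_leD le_Suc_eq)
    next
      case False
      then have "fst (lattice_point w (Suc n)) = x"
        using Suc.prems by (auto simp: lattice_point_Suc split: if_splits)
      then show ?thesis by blast
    qed
  qed (auto simp: lattice_point_0)
  from this[of "length w"] show thesis
    using that assms lattice_point_length[OF assms(1)] by auto
qed

lemma lattice_path_snd_onto:
  assumes "w \<in> combinations k l" "y \<le> l"
  obtains i where "i \<le> length w" "snd (lattice_point w i) = y"
proof -
  have "\<exists>i \<le> n. snd (lattice_point w i) = y" if "n \<le> length w" "y \<le> snd (lattice_point w n)" for n
    using that
  proof (induction n)
    case (Suc n)
    show ?case
    proof (cases "y \<le> snd (lattice_point w n)")
      case True
      then show ?thesis using Suc by (meson Suc_leD le_Suc_eq)
    next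
      case False
      then have "snd (lattice_point w (Suc n)) = y"
        using Suc.prems by (auto simp: lattice_point_Suc split: if_splits)
      then show ?thesis by blast
    qed
  qed (auto simp: lattice_point_0)
  from this[of "length w"] show thesis
    using that assms lattice_point_length[OF assms(1)] by auto
qed

text \<open>The second assumption says that \<open>K\<close> is a chain in the product order. Apart
  from the corner \<open>(k, l)\<close>, it fits into the box with one column or one row less, which
  determines the last step of the path.\<close>

lemma chain_subset_lattice_path:
  assumes "K \<subseteq> {..k} \<times> {..l}"
    and "\<And>x y x' y'. (x, y) \<in> K \<Longrightarrow> (x', y') \<in> K \<Longrightarrow> \<not> (x < x' \<and> y' < y)"
  obtains w where "w \<in> combinations k l" "K \<subseteq> lattice_point w ` {..length w}"
proof -
  have "\<exists>w. w \<in> combinations k l \<and> K \<subseteq> lattice_point w ` {..length w}"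
    using assms
  proof (induction "k + l" arbitrary: k l K rule: less_induct)
    case less
    have extend: ?case
      if "w \<in> combinations k' l'" "K - {(k, l)} \<subseteq> lattice_point w ` {..length w}"
        "w @ [c] \<in> combinations k l" for w c k' l'
    proof (intro exI conjI)
      show "w @ [c] \<in> combinations k l" by (rule that(3))
      have "lattice_point w ` {..length w} = lattice_point (w @ [c]) ` {..length w}"
        by (intro image_cong) (auto simp: lattice_point_def)
      then have "lattice_point w ` {..length w} \<subseteq> lattice_point (w @ [c]) ` {..length (w @ [c])}"
        by auto
      moreover have "(k, l) \<in> lattice_point (w @ [c]) ` {..length (w @ [c])}"
        using lattice_point_length[OF that(3)] by (metis atMost_iff image_eqI order_refl)
      ultimately show "K \<subseteq> lattice_point (w @ [c]) ` {..length (w @ [c])}"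
        using that(2) by blast
    qed
    \<comment> \<open>A point \<open>(k, y)\<close> with \<open>y < l\<close> and a point
      \<open>(x, l)\<close> with \<open>x < k\<close> would be incomparable, so \<open>K\<close>
      without the corner avoids the last column or the last row.\<close>
    consider "k = 0" "l = 0" | "0 < k" "\<forall>p\<in>K - {(k, l)}. fst p < k"
      | "0 < l" "\<forall>p\<in>K - {(k, l)}. snd p < l"
    proof (cases "\<exists>y. y < l \<and> (k, y) \<in> K")
      case True
      then obtain y where y: "y < l" "(k, y) \<in> K" by blast
      have "snd p < l" if "p \<in> K - {(k, l)}" for p
      proof (rule ccontr)
        assume "\<not> snd p < l"
        then have "snd p = l" "fst p < k"
          using that less.prems(1) by (cases p; force)+
        then show False
          using less.prems(2)[of "fst p" l k y] y that by (cases p) auto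
      qed
      then show thesis using that(3) y(1) by fastforce
    next
      case False
      then have *: "fst p < k" if "p \<in> K - {(k, l)}" for p
        using that less.prems(1) by (cases p) (force simp: le_less)
      show thesis
      proof (cases "k = 0")
        case True
        then have "K - {(k, l)} = {}" using * by auto
        then show thesis using that True by blast
      next
        case False
        then show thesis using * that(2) by blast
      qed
    qed
    then show ?case
    proof cases
      case 1
      then have "K \<subseteq> {(0, 0)}" using less.prems(1) by auto
      then show ?thesis
        using 1 by (intro exI[of _ "[]"]) (auto simp: Nil_in_combinations_iff lattice_point_def)
    next
      case 2
      have "K - {(k, l)} \<subseteq> {..k - 1} \<times> {..l}"
      proof
        fix p assume "p \<in> K - {(k, l)}"
        then have "p \<in> {..k} \<times> {..l}" "fst p < k"
          using 2 less.prems(1) by blast+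
        then show "p \<in> {..k - 1} \<times> {..l}" by (cases p) auto
      qed
      then obtain w where "w \<in> combinations (k - 1) l" "K - {(k, l)} \<subseteq> lattice_point w ` {..length w}"
        using less.hyps[of "k - 1" l "K - {(k, l)}"] less.prems(2) 2 by auto
      then show ?thesis
        using 2 by (intro extend[of w "k - 1" l False]) (auto simp: in_combinations_iff)
    next
      case 3
      have "K - {(k, l)} \<subseteq> {..k} \<times> {..l - 1}"
      proof
        fix p assume "p \<in> K - {(k, l)}"
        then have "p \<in> {..k} \<times> {..l}" "snd p < l"
          using 3 less.prems(1) by blast+
        then show "p \<in> {..k} \<times> {..l - 1}" by (cases p) auto
      qed
      then obtain w where "w \<in> combinations k (l - 1)" "K - {(k, l)} \<subseteq> lattice_point w ` {..length w}"
        using less.hyps[of k "l - 1" "K - {(k, l)}"] less.prems(2) 3 by auto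
      then show ?thesis
        using 3 by (intro extend[of w k "l - 1" True]) (auto simp: in_combinations_iff)
    qed
  qed
  then show thesis using that by blast
qed


section \<open>Colorful triangulations as lattice paths\<close>

text \<open>Red points are counted backward from \<open>a\<close> and blue points forward from
  \<open>a + 1\<close>. The grid thus starts at the side between \<open>a\<close> and
  \<open>a + 1\<close> and ends at the side between \<open>1\<close> and \<open>a + b\<close>, and
  the backward count turns crossing into incomparability.\<close>

definition segment :: "nat \<Rightarrow> nat \<times> nat \<Rightarrow> nat set" where
  "segment a p = {a - fst p, Suc (a + snd p)}"

text \<open>The two end points of the path are left out because they are sides of the
  polygon.\<close>

definition path_triangulation :: "nat \<Rightarrow> bool list \<Rightarrow> nat set set" where
  "path_triangulation a w = (\<lambda>i. segment a (lattice_point w i)) ` {0<..<length w}"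

lemma segment_eq_iff:
  "fst p < a \<Longrightarrow> fst q < a \<Longrightarrow> segment a p = segment a q \<longleftrightarrow> p = q"
  by (auto simp: segment_def doubleton_eq_iff prod_eq_iff)

lemma crossing_segment_iff:
  assumes "fst p < a" "fst q < a"
  shows "crossing (segment a p) (segment a q) \<longleftrightarrow>
    fst p < fst q \<and> snd q < snd p \<or> fst q < fst p \<and> snd p < snd q"
  unfolding segment_def using assms by (subst crossing_iff) auto

lemma bichromatic_eq_segment:
  "p \<le> a \<Longrightarrow> a < q \<Longrightarrow> {p, q} = segment a (a - p, q - Suc a)"
  by (auto simp: segment_def)

context
  fixes a b :: nat
  assumes a: "1 \<le> a" and b: "1 \<le> b" and ab: "3 \<le> a + b"
begin

abbreviation (input) "words \<equiv> combinations (a - 1) (b - 1)"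

lemma length_words: "w \<in> words \<Longrightarrow> length w = a + b - 2"
  using a b by (simp add: length_combinations)

lemma lattice_point_bounds:
  assumes "w \<in> words" "i \<le> length w"
  shows "fst (lattice_point w i) < a" "snd (lattice_point w i) < b"
  using lattice_point_le[OF assms] a b by auto

lemma segment_in_sides_or_path:
  assumes "w \<in> words" "i \<le> length w"
  shows "segment a (lattice_point w i) \<in> polygon_sides (a + b) \<union> path_triangulation a w"
proof -
  consider "i = 0" | "i = length w" | "0 < i" "i < length w"
    using assms(2) by linarith
  then show ?thesis
  proof cases
    case 1
    then show ?thesis
      using a b ab by (auto simp: lattice_point_0 segment_def side_iff)
  next
    case 2
    then show ?thesis
      using a b ab by (auto simp: lattice_point_length[OF assms(1)] segment_def side_iff)
  qed (auto simp: path_triangulation_def)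
qed

text \<open>The sum of the coordinates of a lattice point is its index, so a segment of one path can
  only coincide with the segment of the other path at the same index.\<close>

lemma segment_in_path_iff:
  assumes "v \<in> words" "w \<in> words" "i \<le> length w"
  shows "segment a (lattice_point v i) \<in> path_triangulation a w \<longleftrightarrow>
    0 < i \<and> i < length w \<and> lattice_point v i = lattice_point w i"
proof -
  have len: "length v = length w" using assms length_words by simp
  have "i = j" if "lattice_point v i = lattice_point w j" "j \<le> length w" for j
    using that assms(3) len lattice_point_level by metis
  then show ?thesis
    using assms len lattice_point_bounds
    by (auto simp: path_triangulation_def segment_eq_iff image_iff)
qed

lemma path_triangulation_subset: "w \<in> words \<Longrightarrow> path_triangulation a w \<subseteq> diagonals (a + b)"
proof
  fix d assume w: "w \<in> words" and "d \<in> path_triangulation a w"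
  then obtain i where i: "0 < i" "i < length w" and d: "d = segment a (lattice_point w i)"
    by (auto simp: path_triangulation_def)
  show "d \<in> diagonals (a + b)"
    unfolding d segment_def
    using lattice_point_bounds[OF w, of i] lattice_point_level[of i w] i length_words[OF w] ab
    by (subst diagonal_iff) auto
qed

lemma path_triangulation_noncrossing:
  assumes "w \<in> words" "d \<in> path_triangulation a w" "e \<in> path_triangulation a w"
  shows "\<not> crossing d e"
proof -
  obtain i j where "i < length w" "j < length w"
    "d = segment a (lattice_point w i)" "e = segment a (lattice_point w j)"
    using assms by (auto simp: path_triangulation_def)
  then show ?thesis
    using lattice_point_mono[of i j w] lattice_point_mono[of j i w] lattice_point_bounds[OF assms(1)]
    by (cases "i \<le> j") (auto simp: crossing_segment_iff)
qed

lemma segment_in_pathI: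
  assumes "w \<in> words" "i \<le> length w" "d = segment a (lattice_point w i)" "d \<notin> polygon_sides (a + b)"
  shows "d \<in> path_triangulation a w"
  using segment_in_sides_or_path[OF assms(1,2)] assms(3,4) by auto

lemma triangulation_path_triangulation:
  assumes w: "w \<in> words"
  shows "triangulation (a + b) (path_triangulation a w)"
  unfolding triangulation_def
proof (intro conjI ballI)
  show "path_triangulation a w \<subseteq> diagonals (a + b)"
    by (rule path_triangulation_subset[OF w])
next
  fix d e assume "d \<in> path_triangulation a w" "e \<in> path_triangulation a w"
  then show "\<not> crossing d e" by (rule path_triangulation_noncrossing[OF w])
next
  fix d assume d: "d \<in> diagonals (a + b) - path_triangulation a w"
  then obtain p q where pq: "d = {p, q}" "p < q" "1 \<le> p" "q \<le> a + b"
    by (meson DiffD1 diagonalE)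
  have nside: "q \<noteq> Suc p" "\<not> (p = 1 \<and> q = a + b)"
    using d pq ab by (auto simp: diagonal_iff)
  consider "q \<le> a" | "a < p" | "p \<le> a" "a < q" by linarith
  then show "\<exists>e\<in>path_triangulation a w. crossing d e"
  proof cases
    case 1
    \<comment> \<open>The coordinate \<open>a - Suc p\<close> belongs to the red point
      \<open>Suc p\<close>, which lies strictly between \<open>p\<close> and \<open>q\<close>. The
      path has a segment there, and it leaves to a blue point beyond \<open>q\<close>.\<close>
    obtain i where i: "i \<le> length w" "fst (lattice_point w i) = a - Suc p"
    proof -
      have "a - Suc p \<le> a - 1" by simp
      then show thesis using lattice_path_fst_onto[OF w] that by blast
    qed
    have seg: "segment a (lattice_point w i) = {Suc p, Suc (a + snd (lattice_point w i))}"
      using i(2) 1 pq by (simp add: segment_def)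
    then have "segment a (lattice_point w i) \<in> path_triangulation a w"
      using 1 pq nside ab by (intro segment_in_pathI[OF w i(1)]) (auto simp: side_iff)
    moreover have "crossing d (segment a (lattice_point w i))"
      unfolding seg pq(1) using 1 pq nside by (subst crossing_iff) auto
    ultimately show ?thesis by blast
  next
    case 2
    obtain i where i: "i \<le> length w" "snd (lattice_point w i) = p - a"
    proof -
      have "p - a \<le> b - 1" using pq by simp
      then show thesis using lattice_path_snd_onto[OF w] that by blast
    qed
    have seg: "segment a (lattice_point w i) = {a - fst (lattice_point w i), Suc p}"
      using i(2) 2 pq by (simp add: segment_def)
    then have "segment a (lattice_point w i) \<in> path_triangulation a w"
      using 2 pq nside ab by (intro segment_in_pathI[OF w i(1)]) (auto simp: side_iff)
    moreover have "crossing d (segment a (lattice_point w i))"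
      unfolding seg pq(1) using 2 pq nside by (subst crossing_iff) auto
    ultimately show ?thesis by blast
  next
    case 3
    define x where "x = a - p"
    define y where "y = q - Suc a"
    have xy: "x < a" "y < b" and d_seg: "d = segment a (x, y)"
      using 3 pq by (auto simp: x_def y_def segment_def)
    have le: "x + y \<le> length w"
      using xy length_words[OF w] by simp
    \<comment> \<open>Two distinct points on the same level are incomparable, so the segment of the
      path on the level of \<open>d\<close> crosses \<open>d\<close>.\<close>
    let ?p = "lattice_point w (x + y)"
    have level: "fst ?p + snd ?p = x + y"
      by (rule lattice_point_level[OF le])
    have "?p \<noteq> (x, y)"
    proof
      assume "?p = (x, y)"
      then have "d \<in> path_triangulation a w"
        using d d_seg by (intro segment_in_pathI[OF w le]) (auto simp: diagonals_def)
      with d show False by simp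
    qed
    with level have "fst ?p < x \<and> y < snd ?p \<or> x < fst ?p \<and> snd ?p < y"
      by (cases ?p) auto
    then have "crossing d (segment a ?p)"
      unfolding d_seg using xy lattice_point_bounds[OF w le] by (subst crossing_segment_iff) auto
    moreover have "0 < x + y" "x + y < length w"
    proof -
      show "0 < x + y"
        using \<open>?p \<noteq> (x, y)\<close> lattice_point_0[of w] by (cases "x + y = 0") auto
      have "\<not> (x = a - 1 \<and> y = b - 1)"
        using nside pq 3 by (auto simp: x_def y_def)
      then show "x + y < length w"
        using xy length_words[OF w] by linarith
    qed
    ultimately show ?thesis
      by (auto simp: path_triangulation_def)
  qed
qed

text \<open>Points of the same color are joined only if they are consecutive, and three distinct
  points cannot be pairwise consecutive.\<close>

lemma colorful_path_triangulation:
  assumes w: "w \<in> words"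
  shows "colorful a b (path_triangulation a w)"
proof -
  let ?E = "polygon_sides (a + b) \<union> path_triangulation a w"
  have mono: "q = Suc p" if "{p, q} \<in> ?E" "p < q" "q \<le> a \<or> a < p" for p q
    using that(1)
  proof
    assume "{p, q} \<in> polygon_sides (a + b)"
    then show ?thesis using that(2,3) a b ab by (auto simp: side_iff)
  next
    assume "{p, q} \<in> path_triangulation a w"
    then show ?thesis
      using that(2,3) by (auto simp: path_triangulation_def segment_def doubleton_eq_iff)
  qed
  have consecutive: "q = Suc p \<or> p = Suc q"
    if "{p, q} \<in> ?E" "p \<noteq> q" "p \<le> a \<and> q \<le> a \<or> a < p \<and> a < q" for p q
    using mono[of p q] mono[of q p] that by (cases "p < q") (auto simp: insert_commute)
  have "\<not> t \<subseteq> {1..a} \<and> \<not> t \<subseteq> {a + 1..a + b}" if t: "t \<in> triangles (a + b) (path_triangulation a w)" for t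
  proof -
    obtain p q r where pqr: "t = {p, q, r}" "p \<noteq> q" "q \<noteq> r" "p \<noteq> r"
      "{p, q} \<in> ?E" "{q, r} \<in> ?E" "{p, r} \<in> ?E"
      by (rule trianglesE[OF t])
    show ?thesis
      using consecutive[OF pqr(5,2)] consecutive[OF pqr(6,3)] consecutive[OF pqr(7,4)] pqr(1) by auto
  qed
  then show ?thesis
    unfolding colorful_def red_points_def blue_points_def by blast
qed

text \<open>The diagonals of \<open>T\<close> form a chain of grid points, which extends to a
  lattice path. As the segments of that path do not cross each other, maximality of \<open>T\<close>
  gives equality.\<close>

lemma colorful_triangulation_is_path:
  assumes T: "triangulation (a + b) T" and col: "colorful a b T"
  obtains w where "w \<in> words" "T = path_triangulation a w"
proof -
  have diag: "T \<subseteq> diagonals (a + b)" and nc: "\<And>e f. e \<in> T \<Longrightarrow> f \<in> T \<Longrightarrow> \<not> crossing e f"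
    and maximal: "\<And>d. d \<in> diagonals (a + b) \<Longrightarrow> d \<notin> T \<Longrightarrow> \<exists>e\<in>T. crossing d e"
    using T unfolding triangulation_def by auto
  define K where "K = {p. fst p < a \<and> snd p < b \<and> segment a p \<in> T}"
  have T_K: "T \<subseteq> segment a ` K"
  proof
    fix d assume d: "d \<in> T"
    then obtain p q where pq: "d = {p, q}" "p < q" "1 \<le> p" "q \<le> a + b"
      using diag by (meson diagonalE subsetD)
    \<comment> \<open>Colors occupy intervals of labels, so if \<open>p\<close> and \<open>q\<close>
      had the same color, then so would \<open>k\<close>, and the triangle would be
      monochromatic.\<close>
    obtain k where k: "p < k" "k < q" "{p, q, k} \<in> triangles (a + b) T"
      using triangulation_triangle_below[OF T ab] d pq by blast
    then have "\<not> {p, q, k} \<subseteq> {1..a}" "\<not> {p, q, k} \<subseteq> {a + 1..a + b}"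
      using col unfolding colorful_def red_points_def blue_points_def by blast+
    then have "p \<le> a" "a < q"
      using k pq by auto
    moreover from this have "d = segment a (a - p, q - Suc a)"
      using bichromatic_eq_segment pq by simp
    ultimately show "d \<in> segment a ` K"
      using d pq a unfolding K_def by auto
  qed
  have K_box: "K \<subseteq> {..a - 1} \<times> {..b - 1}"
    by (auto simp: K_def)
  have K_chain: "\<not> (x < x' \<and> y' < y)" if "(x, y) \<in> K" "(x', y') \<in> K" for x y x' y'
    using nc[of "segment a (x, y)" "segment a (x', y')"] that by (auto simp: K_def crossing_segment_iff)
  obtain w where w: "w \<in> words" "K \<subseteq> lattice_point w ` {..length w}"
    by (rule chain_subset_lattice_path[OF K_box K_chain])
  have sub: "T \<subseteq> path_triangulation a w"
  proof
    fix d assume d: "d \<in> T"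
    then obtain i where "i \<le> length w" "d = segment a (lattice_point w i)"
      using T_K w(2) by blast
    moreover have "d \<notin> polygon_sides (a + b)"
      using d diag by (auto simp: diagonals_def)
    ultimately show "d \<in> path_triangulation a w"
      using segment_in_pathI[OF w(1)] by blast
  qed
  moreover have "path_triangulation a w \<subseteq> T"
  proof
    fix d assume d: "d \<in> path_triangulation a w"
    then have "\<not> crossing d e" if "e \<in> T" for e
      using path_triangulation_noncrossing[OF w(1) d] that sub by blast
    then show "d \<in> T"
      using maximal d path_triangulation_subset[OF w(1)] by blast
  qed
  ultimately show thesis
    using that w(1) by blast
qed

lemma inj_on_path_triangulation: "inj_on (path_triangulation a) words"
proof (rule inj_onI)
  fix v w assume v: "v \<in> words" and w: "w \<in> words" and eq: "path_triangulation a v = path_triangulation a w"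
  have len: "length v = length w" using v w length_words by simp
  have pt: "lattice_point v i = lattice_point w i" if i: "i \<le> length w" for i
  proof -
    consider "i = 0" | "i = length w" | "0 < i" "i < length w"
      using i by linarith
    then show ?thesis
    proof cases
      case 3
      then have "segment a (lattice_point v i) \<in> path_triangulation a v"
        using v len by (simp add: segment_in_path_iff)
      then show ?thesis
        using v w i by (simp add: eq segment_in_path_iff)
    qed (use lattice_point_length[OF v] lattice_point_length[OF w] len in \<open>simp_all add: lattice_point_0\<close>)
  qed
  show "v = w"
  proof (rule nth_equalityI[OF len])
    fix i assume "i < length v"
    then show "v ! i = w ! i"
      using len pt[of i] pt[of "Suc i"] by (intro lattice_point_eq_imp_nth_eq) auto
  qed
qed

text \<open>
  Both triangulations contain exactly one segment on each level \<open>x + y = i\<close>, so the exchanged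
  segments lie on the same level.
\<close>

lemma adj_if_flip:
  assumes v: "v \<in> words" and w: "w \<in> words"
    and flip: "flip (a + b) (path_triangulation a v) (path_triangulation a w)"
  shows "adj v w"
proof -
  have len: "length v = length w" using v w length_words by simp
  obtain p q r s where pq: "{p, q} \<in> path_triangulation a v"
    and tr: "{p, q, r} \<in> triangles (a + b) (path_triangulation a v)"
    and eq: "path_triangulation a w = path_triangulation a v - {{p, q}} \<union> {{r, s}}"
    using flip unfolding flip_def by (elim exE conjE) (rule that)
  obtain i where i: "0 < i" "i < length v" and pq_i: "{p, q} = segment a (lattice_point v i)"
    using pq by (auto simp: path_triangulation_def)
  \<comment> \<open>The triangle has three distinct corners, so \<open>r\<close> is a new point and
    the segment \<open>{p, q}\<close> really disappears.\<close>
  have "card {p, q, r} = 3"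
    by (rule trianglesE[OF tr]) simp
  moreover have "card {p, q} \<le> 2"
    by (simp add: card_insert_if)
  ultimately have "r \<notin> {p, q}"
    by (auto simp: insert_absorb insert_commute)
  then have "{r, s} \<noteq> {p, q}"
    by auto
  then have "{p, q} \<notin> path_triangulation a w"
    using eq by auto
  then have ne: "lattice_point v i \<noteq> lattice_point w i"
    using pq_i i len segment_in_path_iff[OF v w, of i] by auto
  have pt: "lattice_point v j = lattice_point w j" if j: "j \<le> length v" "j \<noteq> i" for j
  proof -
    consider "j = 0" | "j = length w" | "0 < j" "j < length w"
      using j len by linarith
    then show ?thesis
    proof cases
      case 3
      have "lattice_point v j \<noteq> lattice_point v i"
        using lattice_point_level[of i v] lattice_point_level[of j v] i j by auto
      then have "segment a (lattice_point v j) \<noteq> {p, q}"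
        using pq_i lattice_point_bounds[OF v] i j by (auto simp: segment_eq_iff)
      moreover have "segment a (lattice_point v j) \<in> path_triangulation a v"
        using 3 len v by (simp add: segment_in_path_iff)
      ultimately show ?thesis
        using segment_in_path_iff[OF v w, of j] eq j len by auto
    qed (use lattice_point_length[OF v] lattice_point_length[OF w] len in \<open>simp_all add: lattice_point_0\<close>)
  qed
  obtain m where m: "i = Suc m" using i(1) by (cases i) auto
  have nth: "v ! j = w ! j" if "j < length v" "j \<noteq> m" "j \<noteq> Suc m" for j
    using that len m pt[of j] pt[of "Suc j"] by (intro lattice_point_eq_imp_nth_eq) auto
  \<comment> \<open>The paths agree at \<open>m\<close> and \<open>m + 2\<close> but not in between,
    so the two steps from \<open>m\<close> to \<open>m + 2\<close> are exchanged.\<close>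
  have "v ! m \<noteq> w ! m"
    using ne i pt[of m] len unfolding m by (auto simp: lattice_point_Suc split: if_splits)
  moreover have "v ! m = w ! Suc m \<and> v ! Suc m = w ! m \<or> v ! m = w ! m"
    using pt[of m] pt[of "Suc (Suc m)"] i len unfolding m
    by (auto simp: lattice_point_Suc split: if_splits)
  ultimately have sw: "v ! m \<noteq> v ! Suc m" "w ! m = v ! Suc m" "w ! Suc m = v ! m"
    by auto
  have "w = v[m := v ! Suc m, Suc m := v ! m]"
    using len sw nth i m by (intro nth_equalityI) (auto simp: nth_list_update)
  then show ?thesis
    unfolding adjacent_transposition_def using sw i m by blast
qed

text \<open>Exchanging two steps replaces a corner of a unit square of the grid by the opposite one.
  The four points of the polygon involved form a quadrilateral whose sides are the other two corners
  of the square and two sides between consecutive points of equal color; the exchanged segments are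
  its diagonals.\<close>

lemma flip_if_adj:
  assumes v: "v \<in> words" and w: "w \<in> words" and adj: "adj v w"
  shows "flip (a + b) (path_triangulation a v) (path_triangulation a w)"
proof -
  obtain x c y where vw: "v = x @ c # (\<not> c) # y" "w = x @ (\<not> c) # c # y"
    using adj unfolding adj_iff_append by blast
  have len: "length v = length w" using vw by simp
  define m where "m = length x"
  have m: "Suc (Suc m) \<le> length v" by (simp add: vw m_def)
  have pt: "lattice_point w j = lattice_point v j" if "j \<noteq> Suc m" for j
  proof (cases "j \<le> m")
    case False
    define n where "n = j - m - 2"
    have "j = m + Suc (Suc n)"
      using False that by (simp add: n_def)
    then show ?thesis by (simp add: lattice_point_def vw m_def)
  qed (simp add: lattice_point_def vw m_def)
  let ?e = "segment a (lattice_point v (Suc m))" and ?f = "segment a (lattice_point w (Suc m))"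
  have ne: "segment a (lattice_point v j) \<noteq> ?e" if "j \<noteq> Suc m" "j < length v" for j
  proof -
    have "lattice_point v j \<noteq> lattice_point v (Suc m)"
      using that m lattice_point_level[of j v] lattice_point_level[of "Suc m" v] by auto
    then show ?thesis
      using that m lattice_point_bounds[OF v] by (auto simp: segment_eq_iff)
  qed
  have eq: "path_triangulation a w = path_triangulation a v - {?e} \<union> {?f}"
  proof -
    let ?I = "{0<..<length v} - {Suc m}"
    have "{0<..<length v} = insert (Suc m) ?I"
      using m by auto
    then have "path_triangulation a w = insert ?f ((\<lambda>i. segment a (lattice_point w i)) ` ?I)"
      unfolding path_triangulation_def len[symmetric] by (metis (no_types, lifting) image_insert)
    moreover have "(\<lambda>i. segment a (lattice_point w i)) ` ?I = (\<lambda>i. segment a (lattice_point v i)) ` ?I"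
      by (intro image_cong) (simp_all add: pt)
    moreover have "\<dots> = path_triangulation a v - {?e}"
      unfolding path_triangulation_def using ne by auto
    ultimately show ?thesis by simp
  qed
  have e: "?e \<in> path_triangulation a v"
    using m by (auto simp: path_triangulation_def)
  define X where "X = fst (lattice_point v m)"
  define Y where "Y = snd (lattice_point v m)"
  have pts: "lattice_point v m = (X, Y)"
    "lattice_point v (Suc m) = (if c then (X, Suc Y) else (Suc X, Y))"
    "lattice_point w (Suc m) = (if c then (Suc X, Y) else (X, Suc Y))"
    "lattice_point v (Suc (Suc m)) = (Suc X, Suc Y)"
    by (auto simp: X_def Y_def lattice_point_def vw m_def)
  have XY: "Suc X < a" "Suc Y < b"
    using lattice_point_bounds[OF v m] pts(4) by auto
  let ?E = "polygon_sides (a + b) \<union> path_triangulation a v"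
  have E: "segment a (X, Y) \<in> ?E" "segment a (Suc X, Suc Y) \<in> ?E"
    using segment_in_sides_or_path[OF v, of m] segment_in_sides_or_path[OF v m] m
    by (auto simp: pts)
  have S: "{a - Suc X, a - X} \<in> ?E" "{Suc (a + Y), Suc (a + Suc Y)} \<in> ?E"
    using XY ab by (auto simp: side_iff)
  show ?thesis
  proof (cases c)
    case False
    then have ef: "?e = {a - Suc X, Suc (a + Y)}" "?f = {a - X, Suc (a + Suc Y)}"
      using pts by (auto simp: segment_def)
    show ?thesis
      unfolding eq ef
      by (rule flipI) (use e ef E S XY in \<open>auto simp: segment_def insert_commute\<close>)
  next
    case True
    then have ef: "?e = {a - X, Suc (a + Suc Y)}" "?f = {a - Suc X, Suc (a + Y)}"
      using pts by (auto simp: segment_def)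
    show ?thesis
      unfolding eq ef
      by (rule flipI) (use e ef E S XY in \<open>auto simp: segment_def insert_commute\<close>)
  qed
qed

section \<open>The bijection on vertices and arcs\<close>

lemma bij_betw_path_triangulation:
  "bij_betw (path_triangulation a) words (verts (colorful_flip_graph a b))"
proof -
  have "verts (colorful_flip_graph a b) = {T. triangulation (a + b) T \<and> colorful a b T}"
    by (auto simp: colorful_flip_graph_def associahedron_def)
  moreover have "path_triangulation a ` words = {T. triangulation (a + b) T \<and> colorful a b T}"
    using triangulation_path_triangulation colorful_path_triangulation colorful_triangulation_is_path
    by blast
  ultimately show ?thesis
    using inj_on_path_triangulation by (simp add: bij_betw_def)
qed

lemma arcs_colorful_flip_graph:
  "arcs (colorful_flip_graph a b) =
     map_prod (path_triangulation a) (path_triangulation a) ` arcs (combination_graph (a - 1) (b - 1))"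
proof -
  let ?V = "verts (colorful_flip_graph a b)"
  have V: "?V = path_triangulation a ` words"
    using bij_betw_path_triangulation by (simp add: bij_betw_def)
  have "arcs (colorful_flip_graph a b) = {(S, T). S \<in> ?V \<and> T \<in> ?V \<and> flip (a + b) S T}"
    by (auto simp: colorful_flip_graph_def associahedron_def)
  also have "\<dots> = map_prod (path_triangulation a) (path_triangulation a) ` {(v, w). v \<in> words \<and> w \<in> words \<and> adj v w}"
    unfolding V using adj_if_flip flip_if_adj by force
  finally show ?thesis
    by (simp add: combination_graph_def)
qed

end


section \<open>Transfer along the isomorphism\<close>

lemma set_vwalk_arcs_subset_iff: "set (vwalk_arcs p) \<subseteq> A \<longleftrightarrow> successively (\<lambda>u v. (u, v) \<in> A) p"
  by (induction p rule: vwalk_arcs.induct) auto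

lemma has_hamilton_path_iff:
  "has_hamilton_path G \<longleftrightarrow> (\<exists>x y. ham_path (\<lambda>u v. (u, v) \<in> arcs_ends G) (verts G) x y)"
  unfolding has_hamilton_path_def ham_path_def vpath_def vwalk_def set_vwalk_arcs_subset_iff by blast

lemma has_hamilton_cycle_iff:
  "has_hamilton_cycle G \<longleftrightarrow> ham_cycle (\<lambda>u v. (u, v) \<in> arcs_ends G) (verts G)"
  unfolding has_hamilton_cycle_def ham_cycle_def vpath_def vwalk_def set_vwalk_arcs_subset_iff
  by auto

lemma ham_path_bij:
  assumes "bij_betw f S S'" "\<And>u v. u \<in> S \<Longrightarrow> v \<in> S \<Longrightarrow> R' (f u) (f v) \<longleftrightarrow> R u v"
  shows "(\<exists>x y. ham_path R' S' x y) \<longleftrightarrow> (\<exists>x y. ham_path R S x y)"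
proof
  assume "\<exists>x y. ham_path R S x y"
  then obtain x y where "ham_path R S x y" by blast
  then have "ham_path R' (f ` S) (f x) (f y)"
    using assms by (intro ham_path_image) (auto simp: bij_betw_def)
  then show "\<exists>x y. ham_path R' S' x y"
    using assms(1) by (auto simp: bij_betw_def)
next
  let ?g = "the_inv_into S f"
  have g: "bij_betw ?g S' S"
    by (rule bij_betw_the_inv_into[OF assms(1)])
  have fg: "f (?g u) = u" if "u \<in> S'" for u
    using that assms(1) by (simp add: f_the_inv_into_f_bij_betw)
  assume "\<exists>x y. ham_path R' S' x y"
  then obtain x y where "ham_path R' S' x y" by blast
  then have "ham_path R (?g ` S') (?g x) (?g y)"
  proof (rule ham_path_image)
    fix u v assume uv: "u \<in> S'" "v \<in> S'" "R' u v"
    then have "?g u \<in> S" "?g v \<in> S" using g by (auto simp: bij_betw_def)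
    then show "R (?g u) (?g v)"
      using assms(2)[of "?g u" "?g v"] uv fg by simp
  qed (use g in \<open>auto simp: bij_betw_def\<close>)
  then show "\<exists>x y. ham_path R S x y"
    using g by (auto simp: bij_betw_def)
qed

lemma ham_cycle_bij:
  assumes "bij_betw f S S'" "\<And>u v. u \<in> S \<Longrightarrow> v \<in> S \<Longrightarrow> R' (f u) (f v) \<longleftrightarrow> R u v" "ham_cycle R' S'"
  shows "ham_cycle R S"
proof -
  let ?g = "the_inv_into S f"
  have g: "bij_betw ?g S' S"
    by (rule bij_betw_the_inv_into[OF assms(1)])
  have fg: "f (?g u) = u" if "u \<in> S'" for u
    using that assms(1) by (simp add: f_the_inv_into_f_bij_betw)
  have R: "R (?g u) (?g v)" if uv: "u \<in> S'" "v \<in> S'" "R' u v" for u v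
  proof -
    have "?g u \<in> S" "?g v \<in> S" using uv g by (auto simp: bij_betw_def)
    then show ?thesis
      using assms(2)[of "?g u" "?g v"] uv fg by simp
  qed
  obtain p where p: "distinct p" "set p = S'" "successively R' p" "3 \<le> length p" "R' (last p) (hd p)"
    using assms(3) unfolding ham_cycle_def by blast
  then have "p \<noteq> []" by auto
  then have "hd p \<in> S'" "last p \<in> S'" using p(2) by auto
  moreover have "successively (\<lambda>u v. R (?g u) (?g v)) p"
    using p(2,3) R by (auto elim: successively_mono)
  ultimately show ?thesis
    unfolding ham_cycle_def using p g R \<open>p \<noteq> []\<close>
    by (intro exI[of _ "map ?g p"]) (auto simp: successively_map distinct_map hd_map last_map bij_betw_def)
qed

theorem theorem3:
  fixes a b :: nat
  assumes "a \<ge> 1" and "b \<ge> 1" and "a + b \<ge> 3"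
  shows "digraph_iso (colorful_flip_graph a b) (combination_graph (a - 1) (b - 1)) \<and>
    (has_hamilton_path (colorful_flip_graph a b) \<longleftrightarrow>
       a \<in> {1, 2} \<or> b \<in> {1, 2} \<or> (even a \<and> even b)) \<and>
    (a \<ge> 2 \<and> b \<ge> 2 \<longrightarrow> \<not> has_hamilton_cycle (colorful_flip_graph a b))"
proof -
  let ?F = "colorful_flip_graph a b" and ?H = "combination_graph (a - 1) (b - 1)"
  let ?t = "path_triangulation a" and ?W = "combinations (a - 1) (b - 1)"
  have bij: "bij_betw ?t ?W (verts ?F)"
    by (rule bij_betw_path_triangulation[OF assms])
  note arcsF = arcs_colorful_flip_graph[OF assms]
  have H: "verts ?H = ?W" "arcs ?H = {(v, w). v \<in> ?W \<and> w \<in> ?W \<and> adj v w}" "tail ?H = fst" "head ?H = snd"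
    by (simp_all add: combination_graph_def)
  have F: "tail ?F = fst" "head ?F = snd"
    by (simp_all add: colorful_flip_graph_def associahedron_def induce_subgraph_def)
  have inj: "inj_on ?t ?W" and img: "?t ` ?W = verts ?F"
    using bij by (auto simp: bij_betw_def)
  have arc_iff: "(?t v, ?t w) \<in> arcs_ends ?F \<longleftrightarrow> adj v w" if "v \<in> ?W" "w \<in> ?W" for v w
  proof -
    have "arcs_ends ?F = arcs ?F"
      by (simp add: arcs_ends_def arc_to_ends_def F)
    then show ?thesis
      unfolding arcsF H(2) using that by (auto dest: inj_onD[OF inj] simp del: One_nat_def)
  qed
  \<comment> \<open>The isomorphism is given from words to triangulations, where it is explicit, and
    reversed afterwards.\<close>
  have "digraph_iso ?H ?F"
    unfolding digraph_iso_def pre_digraph.digraph_isomorphism_def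
  proof (intro exI conjI)
    let ?f = "\<lparr>iso_verts = ?t, iso_arcs = map_prod ?t ?t, iso_head = snd, iso_tail = fst\<rparr>"
    show "wf_digraph ?H"
      by unfold_locales (auto simp: H simp del: One_nat_def)
    show "inj_on (iso_verts ?f) (verts ?H)"
      using inj by (simp add: H del: One_nat_def)
    show "inj_on (iso_arcs ?f) (arcs ?H)"
      using inj by (auto simp: H inj_on_def simp del: One_nat_def)
    show "\<forall>e\<in>arcs ?H. iso_verts ?f (tail ?H e) = iso_tail ?f (iso_arcs ?f e) \<and>
        iso_verts ?f (head ?H e) = iso_head ?f (iso_arcs ?f e)"
      by (simp add: H del: One_nat_def)
    show "?F = app_iso ?f ?H"
      by (rule pre_digraph.equality) (simp_all add: F H(1) img arcsF del: One_nat_def)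
  qed
  moreover have "wf_digraph ?H"
    by unfold_locales (auto simp: H simp del: One_nat_def)
  ultimately have "digraph_iso ?F ?H"
    by (rule digraph_iso_swap[rotated])
  moreover have "has_hamilton_path ?F \<longleftrightarrow> a \<in> {1, 2} \<or> b \<in> {1, 2} \<or> (even a \<and> even b)"
  proof -
    have "has_hamilton_path ?F \<longleftrightarrow> (\<exists>x y. ham_path adj ?W x y)"
      unfolding has_hamilton_path_iff by (rule ham_path_bij[OF bij]) (rule arc_iff)
    \<comment> \<open>The shift by one turns parameters at most 1 into \<open>a\<close> or
      \<open>b\<close> in {1, 2}, and odd parameters into even \<open>a\<close> and
      \<open>b\<close>.\<close>
    also have "\<dots> \<longleftrightarrow> a \<in> {1, 2} \<or> b \<in> {1, 2} \<or> (even a \<and> even b)"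
      unfolding ham_path_combinations_iff using assms(1,2) by auto
    finally show ?thesis .
  qed
  moreover have "\<not> has_hamilton_cycle ?F"
  proof
    assume "has_hamilton_cycle ?F"
    then have "ham_cycle adj ?W"
      unfolding has_hamilton_cycle_iff by (rule ham_cycle_bij[OF bij, rotated]) (rule arc_iff)
    then show False
      using no_ham_cycle_combinations by blast
  qed
  ultimately show ?thesis by blast
qed

end
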